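(* Let $n,\ell,m_x,m_y$ be positive integers, let $\mathbb{Q}\subset\mathbb{R}^\ell$ be a set, and consider the following two settings. (LMI setting) Let $F_0,F_1,\dots,F_{m_x}:\mathbb{Q}\to\mathbb{R}^{n\times n}$ be arbitrary functions taking values in real symmetric $n\times n$ matrices, set $m_\theta=m_x$, $\theta=x\in\mathbb{R}^{m_x}$, and $F_{\mathrm{LMI}}(\theta,q)=F_0(q)+\sum_{i=1}^{m_x}x_iF_i(q)$. Define $g:\mathbb{R}^{m_\theta}\times\mathbb{Q}\to\{0,1\}$ by $g(\theta,q)=0$ if $F_{\mathrm{LMI}}(\theta,q)\succ0$ (positive definite) and $g(\theta,q)=1$ otherwise. (BMI setting) Let $F_0,F_i,G_j,H_{ij}:\mathbb{Q}\to\mathbb{R}^{n\times n}$ ($i=1,\dots,m_x$, $j=1,\dots,m_y$) be arbitrary functions taking values in real symmetric $n\times n$ matrices, set $m_\theta=m_x+m_y$, $\theta=(x,y)\in\mathbb{R}^{m_x}\times\mathbb{R}^{m_y}$, and $F_{\mathrm{BMI}}(\theta,q)=F_0(q)+\sum_{i=1}^{m_x}x_iF_i(q)+\sum_{j=1}^{m_y}y_jG_j(q)+\sum_{i=1}^{m_x}\sum_{j=1}^{m_y}x_iy_jH_{ij}(q)$. Define $g(\theta,q)=0$ if $F_{\mathrm{BMI}}(\theta,q)\succ0$ and $g(\theta,q)=1$ otherwise. In either setting, the VC-dimension $d$ of the family $\mathcal{G}=\{g(\theta,\cdot):\theta\in\mathbb{R}^{m_\theta}\}$ satisfies $$d\le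 2m_\theta\log_2(4en^2),$$ where $e$ is Euler's number.
   Context: For a family $\mathcal{G}$ of functions $\mathbb{Q}\to\{0,1\}$, a finite set $\{q^{(1)},\dots,q^{(N)}\}\subset\mathbb{Q}$ is shattered by $\mathcal{G}$ if for every subset $S$ of it there is $h\in\mathcal{G}$ with $\{q^{(i)}:h(q^{(i)})=1\}=S$. The VC-dimension of $\mathcal{G}$ is the largest integer $d$ such that some set of $d$ points of $\mathbb{Q}$ is shattered by $\mathcal{G}$. $A\succ0$ means the symmetric matrix $A$ is positive definite. *)

theory Defs
  imports "HOL-Analysis.Analysis"
begin

definition sym_mat :: "real^'n^'n \<Rightarrow> bool" where
  "sym_mat A \<longleftrightarrow> transpose A = A"

definition pos_def :: "real^'n^'n \<Rightarrow> bool" where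
  "pos_def A \<longleftrightarrow> sym_mat A \<and> (\<forall>v. v \<noteq> 0 \<longrightarrow> v \<bullet> (A *v v) > 0)"

definition shatters :: "('q \<Rightarrow> bool) set \<Rightarrow> 'q set \<Rightarrow> bool" where
  "shatters G S \<longleftrightarrow> (\<forall>T. T \<subseteq> S \<longrightarrow> (\<exists>h\<in>G. {q\<in>S. h q} = T))"

definition vc_dim_le :: "('q \<Rightarrow> bool) set \<Rightarrow> 'q set \<Rightarrow> real \<Rightarrow> bool" where
  "vc_dim_le G Q d \<longleftrightarrow> (\<forall>S. finite S \<and> S \<subseteq> Q \<and> shatters G S \<longrightarrow> real (card S) \<le> d)"

definition F_LMI :: "(real^'l \<Rightarrow> real^'n^'n) \<Rightarrow> (nat \<Rightarrow> real^'l \<Rightarrow> real^'n^'n) \<Rightarrow> nat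
    \<Rightarrow> (nat \<Rightarrow> real) \<Rightarrow> real^'l \<Rightarrow> real^'n^'n" where
  "F_LMI F0 F mx x q = F0 q + (\<Sum>i\<in>{1..mx}. x i *\<^sub>R F i q)"

definition F_BMI :: "(real^'l \<Rightarrow> real^'n^'n) \<Rightarrow> (nat \<Rightarrow> real^'l \<Rightarrow> real^'n^'n)
    \<Rightarrow> (nat \<Rightarrow> real^'l \<Rightarrow> real^'n^'n) \<Rightarrow> (nat \<Rightarrow> nat \<Rightarrow> real^'l \<Rightarrow> real^'n^'n)
    \<Rightarrow> nat \<Rightarrow> nat \<Rightarrow> (nat \<Rightarrow> real) \<Rightarrow> (nat \<Rightarrow> real) \<Rightarrow> real^'l \<Rightarrow> real^'n^'n" where
  "F_BMI F0 F G H mx my x y q = F0 q + (\<Sum>i\<in>{1..mx}. x i *\<^sub>R F i q)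
      + (\<Sum>j\<in>{1..my}. y j *\<^sub>R G j q)
      + (\<Sum>i\<in>{1..mx}. \<Sum>j\<in>{1..my}. (x i * y j) *\<^sub>R H i j q)"

text \<open>g(theta,q) = 1 (True) iff the matrix is NOT positive definite.\<close>
definition G_LMI where
  "G_LMI F0 F mx = {(\<lambda>q. \<not> pos_def (F_LMI F0 F mx x q)) | x. \<forall>i. i \<notin> {1..mx} \<longrightarrow> x i = 0}"

definition G_BMI where
  "G_BMI F0 F G H mx my = {(\<lambda>q. \<not> pos_def (F_BMI F0 F G H mx my x y q)) | x y.
     (\<forall>i. i \<notin> {1..mx} \<longrightarrow> x i = 0) \<and> (\<forall>j. j \<notin> {1..my} \<longrightarrow> y j = 0)}"

end

theory Submission
  imports Defs
begin

text \<open>Shattering \<open>N\<close> points by definiteness of matrices that depend polynomially on \<open>m\<close> parameters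
  yields \<open>2\<^sup>N\<close> cells in parameter space, bounded by zero sets of determinants. Multiplying the
  determinants in \<open>m\<close> groups gives polynomials \<open>g\<^sub>b\<close> of degree at most \<open>K\<close>, about \<open>2nN/m\<close>. In each
  cell a smoothed logarithmic barrier \<open>\<Sum>\<^sub>b ln \<bar>g\<^sub>b\<bar> - \<Sum>\<^sub>j x\<^sub>j\<^bsup>2K+2\<^esup>\<close> attains an interior maximum. With one slack
  variable per group, the critical equations of all cells form a single polynomial system in \<open>2m\<close>
  variables whose leading terms are pure powers of the variables, so by linear algebra it has at most
  \<open>(2(2K+1))\<^sup>m\<close> solutions. Hence \<open>2\<^sup>N \<le> (2(2K+1))\<^sup>m\<close>. Only \<open>m\<close> slack variables are spent, which is
  what keeps the resulting bound on \<open>N/m\<close> independent of \<open>m\<close>.\<close>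

section \<open>Weighted polynomial functions\<close>

text \<open>Polynomials are represented semantically, as functions with a derivation, so closure
  properties are inductions. The index \<open>d\<close> is only an upper bound for the weighted
  degree, which spares all reasoning about cancellation.\<close>

inductive wpoly :: "'v set \<Rightarrow> ('v \<Rightarrow> nat) \<Rightarrow> nat \<Rightarrow> (('v \<Rightarrow> real) \<Rightarrow> real) \<Rightarrow> bool"
  for V w where
    const: "wpoly V w d (\<lambda>_. c)"
  | add: "wpoly V w d f \<Longrightarrow> wpoly V w d g \<Longrightarrow> wpoly V w d (\<lambda>z. f z + g z)"
  | var_mult: "wpoly V w d f \<Longrightarrow> v \<in> V \<Longrightarrow> d + w v \<le> d' \<Longrightarrow> wpoly V w d' (\<lambda>z. z v * f z)"

lemma wpoly_mono: "wpoly V w d f \<Longrightarrow> d \<le> d' \<Longrightarrow> wpoly V w d' f"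
proof (induction arbitrary: d' rule: wpoly.induct)
  case (var_mult d f v e)
  then show ?case by (intro wpoly.var_mult[where d=d]) auto
qed (auto intro: wpoly.intros)

lemma wpoly_cmult: "wpoly V w d f \<Longrightarrow> wpoly V w d (\<lambda>z. c * f z)"
proof (induction rule: wpoly.induct)
  case (add d f g)
  from wpoly.add[OF add.IH] show ?case by (simp add: algebra_simps)
next
  case (var_mult d f v d')
  from wpoly.var_mult[OF var_mult.IH var_mult.hyps(2,3)] show ?case
    by (simp add: algebra_simps)
qed (auto intro: wpoly.intros)

lemma wpoly_var: "v \<in> V \<Longrightarrow> w v \<le> d \<Longrightarrow> wpoly V w d (\<lambda>z. z v)"
  using wpoly.var_mult[OF wpoly.const[of V w 0 1]] by simp

lemma wpoly_diff: "wpoly V w d f \<Longrightarrow> wpoly V w d g \<Longrightarrow> wpoly V w d (\<lambda>z. f z - g z)"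
  using wpoly.add[of V w d f "\<lambda>z. (-1) * g z"] wpoly_cmult[of V w d g "-1"] by simp

lemma wpoly_mult: "wpoly V w d f \<Longrightarrow> wpoly V w e g \<Longrightarrow> wpoly V w (d + e) (\<lambda>z. f z * g z)"
proof (induction rule: wpoly.induct)
  case (const d c)
  then show ?case by (auto intro: wpoly_cmult wpoly_mono)
next
  case (add d f1 f2)
  from wpoly.add[OF add.IH(1)[OF add.prems] add.IH(2)[OF add.prems]] show ?case
    by (simp add: algebra_simps)
next
  case (var_mult d f v d')
  from wpoly.var_mult[OF var_mult.IH[OF var_mult.prems] var_mult.hyps(2), of "d' + e"] var_mult.hyps(3)
  show ?case by (simp add: algebra_simps)
qed

lemma wpoly_sum: "(\<And>i. i \<in> A \<Longrightarrow> wpoly V w d (f i)) \<Longrightarrow> wpoly V w d (\<lambda>z. \<Sum>i\<in>A. f i z)"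
  by (induction A rule: infinite_finite_induct) (auto intro: wpoly.intros)

lemma wpoly_prod:
  "(\<And>i. i \<in> A \<Longrightarrow> wpoly V w (d i) (f i)) \<Longrightarrow> wpoly V w (\<Sum>i\<in>A. d i) (\<lambda>z. \<Prod>i\<in>A. f i z)"
  by (induction A rule: infinite_finite_induct) (auto intro: wpoly.const wpoly_mult)

text \<open>Serves to turn ordinary degree \<open>K\<close> into weight \<open>2 * K\<close> once
  every parameter has weight 2.\<close>

lemma wpoly_weights: "wpoly V w d f \<Longrightarrow> (\<And>v. v \<in> V \<Longrightarrow> w' v = k * w v) \<Longrightarrow> wpoly V w' (k * d) f"
proof (induction rule: wpoly.induct)
  case (var_mult d f v d')
  have "k * d + w' v \<le> k * d'"
    using var_mult.prems[OF var_mult.hyps(2)] var_mult.hyps(3)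
    by (metis add_mult_distrib2 mult_le_mono2)
  with var_mult show ?case by (auto intro: wpoly.var_mult)
qed (auto intro: wpoly.intros)

lemma wpoly_reindex:
  "wpoly V w d f \<Longrightarrow> (\<And>v. v \<in> V \<Longrightarrow> h v \<in> V') \<Longrightarrow> (\<And>v. v \<in> V \<Longrightarrow> w' (h v) = w v)
    \<Longrightarrow> wpoly V' w' d (\<lambda>z. f (\<lambda>v. z (h v)))"
proof (induction rule: wpoly.induct)
  case (var_mult d f v d')
  then show ?case by (intro wpoly.var_mult[where d=d]) auto
qed (auto intro: wpoly.intros)

lemma wpoly_continuous: "wpoly V w d f \<Longrightarrow> continuous_on UNIV f"
  by (induction rule: wpoly.induct) (auto intro!: continuous_intros)

text \<open>Keeping \<open>d\<close> instead of lowering it avoids truncated subtraction. The loss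
  is harmless: a derivative times one slack variable only has to stay below weight
  \<open>4 * K + 2\<close>.\<close>

lemma wpoly_partial:
  "wpoly V w d f \<Longrightarrow> \<exists>f'. wpoly V w d f' \<and>
     (\<forall>x. ((\<lambda>t. f (x(j := t))) has_real_derivative f' x) (at (x j)))"
proof (induction rule: wpoly.induct)
  case (const d c)
  show ?case by (rule exI[of _ "\<lambda>_. 0"]) (auto intro: wpoly.const)
next
  case (add d f g)
  then obtain f' g' where "wpoly V w d f'" "wpoly V w d g'"
    "\<And>x. ((\<lambda>t. f (x(j := t))) has_real_derivative f' x) (at (x j))"
    "\<And>x. ((\<lambda>t. g (x(j := t))) has_real_derivative g' x) (at (x j))" by blast
  then show ?case
    by (intro exI[of _ "\<lambda>x. f' x + g' x"]) (auto intro: wpoly.add DERIV_add simp del: fun_upd_apply)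
next
  case (var_mult d f v d')
  then obtain f' where f': "wpoly V w d f'"
    "\<And>x. ((\<lambda>t. f (x(j := t))) has_real_derivative f' x) (at (x j))" by blast
  let ?g = "\<lambda>x. (if v = j then f x else 0) + x v * f' x"
  have "wpoly V w d' (\<lambda>x. if v = j then f x else 0)"
    using var_mult.hyps(1,3) by (cases "v = j") (auto intro: wpoly_mono wpoly.const)
  moreover have "wpoly V w d' (\<lambda>x. x v * f' x)"
    using f'(1) var_mult.hyps by (intro wpoly.var_mult[where d=d])
  ultimately have "wpoly V w d' ?g" by (rule wpoly.add)
  moreover have "((\<lambda>t. (x(j := t)) v * f (x(j := t))) has_real_derivative ?g x) (at (x j))" for x
    by (cases "v = j") (auto intro!: derivative_eq_intros f'(2))
  ultimately show ?case by blast
qed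

text \<open>A mixed term is dominated by a pure power of its larger variable, and lower powers by 1
  plus the top power.\<close>

lemma wpoly_growth:
  assumes "finite V" "wpoly V (\<lambda>_. 1) d f"
  shows "\<exists>A\<ge>0. \<forall>x. \<bar>f x\<bar> \<le> A * (1 + (\<Sum>j\<in>V. \<bar>x j\<bar> ^ d))"
  using assms(2)
proof (induction rule: wpoly.induct)
  case (const d c)
  have "\<bar>c\<bar> * 1 \<le> \<bar>c\<bar> * (1 + (\<Sum>j\<in>V. \<bar>x j\<bar> ^ d))" for x :: "_ \<Rightarrow> real"
    by (intro mult_left_mono) (auto intro!: sum_nonneg)
  then show ?case by (intro exI[of _ "\<bar>c\<bar>"]) auto
next
  case (add d f g)
  then obtain A B where A: "A \<ge> 0" "\<And>x. \<bar>f x\<bar> \<le> A * (1 + (\<Sum>j\<in>V. \<bar>x j\<bar> ^ d))"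
    and B: "B \<ge> 0" "\<And>x. \<bar>g x\<bar> \<le> B * (1 + (\<Sum>j\<in>V. \<bar>x j\<bar> ^ d))" by blast
  have "\<bar>f x + g x\<bar> \<le> (A + B) * (1 + (\<Sum>j\<in>V. \<bar>x j\<bar> ^ d))" for x
    using A(2)[of x] B(2)[of x] by (simp add: distrib_right)
  with A(1) B(1) show ?case by (intro exI[of _ "A + B"]) auto
next
  case (var_mult d f v d')
  then obtain A where A: "A \<ge> 0" "\<And>x. \<bar>f x\<bar> \<le> A * (1 + (\<Sum>j\<in>V. \<bar>x j\<bar> ^ d))" by blast
  have pw: "\<bar>s\<bar> ^ a \<le> 1 + \<bar>s\<bar> ^ d'" if "a \<le> d'" for s :: real and a
  proof (cases "\<bar>s\<bar> \<le> 1")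
    case True
    then have "\<bar>s\<bar> ^ a \<le> 1" by (simp add: power_le_one)
    also have "\<dots> \<le> 1 + \<bar>s\<bar> ^ d'" by simp
    finally show ?thesis .
  next
    case False
    then have "\<bar>s\<bar> ^ a \<le> \<bar>s\<bar> ^ d'" using that by (intro power_increasing) auto
    then show ?thesis by simp
  qed
  have mixed: "\<bar>s\<bar> * \<bar>t\<bar> ^ d \<le> (1 + \<bar>s\<bar> ^ d') + (1 + \<bar>t\<bar> ^ d')" for s t :: real
  proof (cases "\<bar>s\<bar> \<le> \<bar>t\<bar>")
    case True
    then have "\<bar>s\<bar> * \<bar>t\<bar> ^ d \<le> \<bar>t\<bar> ^ Suc d" by (simp add: mult_right_mono)
    also have "\<dots> \<le> 1 + \<bar>t\<bar> ^ d'" using var_mult.hyps(3) by (intro pw) auto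
    finally show ?thesis by (smt (verit) zero_le_power)
  next
    case False
    then have "\<bar>s\<bar> * \<bar>t\<bar> ^ d \<le> \<bar>s\<bar> ^ Suc d"
      by (simp add: mult_left_mono power_mono)
    also have "\<dots> \<le> 1 + \<bar>s\<bar> ^ d'" using var_mult.hyps(3) by (intro pw) auto
    finally show ?thesis by (smt (verit) zero_le_power)
  qed
  define n where "n = real (card V)"
  have "\<bar>x v * f x\<bar> \<le> (A * (3 * n + 2)) * (1 + (\<Sum>j\<in>V. \<bar>x j\<bar> ^ d'))" for x
  proof -
    let ?T = "1 + (\<Sum>j\<in>V. \<bar>x j\<bar> ^ d')"
    have one: "1 + \<bar>x j\<bar> ^ d' \<le> ?T" if "j \<in> V" for j
      using member_le_sum[OF that, of "\<lambda>j. \<bar>x j\<bar> ^ d'"] assms(1) by simp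
    have T1: "1 \<le> ?T" by (simp add: sum_nonneg)
    have "\<bar>x v * f x\<bar> \<le> \<bar>x v\<bar> * (A * (1 + (\<Sum>j\<in>V. \<bar>x j\<bar> ^ d)))"
      using A(2)[of x] by (simp add: abs_mult mult_left_mono)
    also have "\<dots> = A * (\<bar>x v\<bar> + (\<Sum>j\<in>V. \<bar>x v\<bar> * \<bar>x j\<bar> ^ d))"
      by (simp add: algebra_simps sum_distrib_left)
    also have "\<dots> \<le> A * (?T + (\<Sum>j\<in>V. 2 * ?T))"
    proof (intro mult_left_mono add_mono sum_mono)
      show "\<bar>x v\<bar> \<le> ?T" using pw[of 1 "x v"] one[OF var_mult.hyps(2)] var_mult.hyps(3) by simp
      show "\<bar>x v\<bar> * \<bar>x j\<bar> ^ d \<le> 2 * ?T" if "j \<in> V" for j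
        using order_trans[OF mixed[of "x v" "x j"] add_mono[OF one[OF var_mult.hyps(2)] one[OF that]]]
        by (simp only: mult_2)
    qed (fact A(1))
    also have "\<dots> = A * (1 + 2 * n) * ?T" by (simp add: n_def algebra_simps)
    also have "\<dots> \<le> A * (3 * n + 2) * ?T"
      using A(1) T1 by (intro mult_right_mono mult_left_mono) (auto simp: n_def)
    finally show ?thesis .
  qed
  moreover have "A * (3 * n + 2) \<ge> 0" using A(1) by (simp add: n_def)
  ultimately show ?case by blast
qed

section \<open>Counting solutions of triangular-at-infinity systems\<close>

text \<open>Gaussian elimination: each equation with a nonzero coefficient expresses one unknown
  through the others, so some unknown is left free.\<close>

lemma homogeneous_system_nontrivial:
  fixes M :: "'e \<Rightarrow> 'x \<Rightarrow> real"
  assumes "finite E" "finite X" "card E < card X"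
  shows "\<exists>c. (\<exists>z\<in>X. c z \<noteq> 0) \<and> (\<forall>e\<in>E. (\<Sum>z\<in>X. c z * M e z) = 0)"
  using assms
proof (induction E arbitrary: X M rule: finite_induct)
  case empty
  then obtain z where "z \<in> X" by fastforce
  then show ?case by (intro exI[of _ "\<lambda>_. 1"]) auto
next
  case (insert e E)
  show ?case
  proof (cases "\<forall>z\<in>X. M e z = 0")
    case True
    with insert.IH[of X M] insert.prems insert.hyps show ?thesis by auto
  next
    case False
    then obtain y where y: "y \<in> X" "M e y \<noteq> 0" by blast
    define X' where "X' = X - {y}"
    have X': "finite X'" "card E < card X'" "X = insert y X'" "y \<notin> X'"
      using insert y by (auto simp: X'_def)
    \<comment> \<open>The coefficients are those left after the unknown at \<open>y\<close> has been
      eliminated by means of equation \<open>e\<close>.\<close>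
    obtain c where c: "\<exists>z\<in>X'. c z \<noteq> 0"
      "\<And>e'. e' \<in> E \<Longrightarrow> (\<Sum>z\<in>X'. c z * (M e' z - M e' y * M e z / M e y)) = 0"
      using insert.IH[OF X'(1,2), of "\<lambda>e' z. M e' z - M e' y * M e z / M e y"] by blast
    define s where "s = (\<Sum>z\<in>X'. c z * M e z) / M e y"
    define c' where "c' = c(y := - s)"
    have sum: "(\<Sum>z\<in>X. c' z * M e' z) = (\<Sum>z\<in>X'. c z * M e' z) - s * M e' y" for e'
    proof -
      have "(\<Sum>z\<in>X'. c' z * M e' z) = (\<Sum>z\<in>X'. c z * M e' z)"
        using X'(4) by (intro sum.cong) (auto simp: c'_def)
      then show ?thesis using X' by (simp add: c'_def)
    qed
    have "(\<Sum>z\<in>X. c' z * M e' z) = 0" if "e' \<in> insert e E" for e'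
    proof (cases "e' = e")
      case True
      then show ?thesis using y by (simp add: sum s_def)
    next
      case False
      with that have "e' \<in> E" by simp
      from c(2)[OF this] have "(\<Sum>z\<in>X'. c z * M e' z) = (\<Sum>z\<in>X'. M e' y / M e y * (c z * M e z))"
        by (simp add: algebra_simps sum_subtractf)
      also have "\<dots> = s * M e' y" unfolding sum_distrib_left[symmetric] by (simp add: s_def)
      finally show ?thesis by (simp add: sum)
    qed
    moreover have "\<exists>z\<in>X. c' z \<noteq> 0" using c(1) X' by (auto simp: c'_def)
    ultimately show ?thesis by blast
  qed
qed

text \<open>The functional \<open>f \<mapsto> \<Sum>z\<in>X. c z * f z\<close> is linear, so only
  monomials matter. The factor with exponents \<open>b\<close> makes the induction go through: a
  variable split off from \<open>f\<close> moves into it.\<close>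

lemma wpoly_functional_zero:
  fixes c :: "('v \<Rightarrow> real) \<Rightarrow> real"
  assumes "finite V" "wpoly V w d f"
    and "\<And>a. (\<Sum>v\<in>V. a v * w v) \<le> D \<Longrightarrow> (\<Sum>z\<in>X. c z * (\<Prod>v\<in>V. z v ^ a v)) = 0"
    and "(\<Sum>v\<in>V. b v * w v) + d \<le> D"
  shows "(\<Sum>z\<in>X. c z * ((\<Prod>v\<in>V. z v ^ b v) * f z)) = 0"
  using assms(2,4)
proof (induction arbitrary: b rule: wpoly.induct)
  case (const d k)
  have "(\<Sum>z\<in>X. c z * ((\<Prod>v\<in>V. z v ^ b v) * k)) = k * (\<Sum>z\<in>X. c z * (\<Prod>v\<in>V. z v ^ b v))"
    by (simp add: sum_distrib_left algebra_simps)
  with assms(3)[of b] const show ?case by simp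
next
  case (add d f g)
  then show ?case by (simp add: algebra_simps sum.distrib)
next
  case (var_mult d f u d')
  let ?b = "b(u := Suc (b u))"
  note split = sum.remove[OF assms(1) var_mult.hyps(2)] prod.remove[OF assms(1) var_mult.hyps(2)]
  have "(\<Sum>v\<in>V - {u}. ?b v * w v) = (\<Sum>v\<in>V - {u}. b v * w v)" by (rule sum.cong) auto
  then have "(\<Sum>v\<in>V. ?b v * w v) = (\<Sum>v\<in>V. b v * w v) + w u" by (simp add: split)
  with var_mult have "(\<Sum>z\<in>X. c z * ((\<Prod>v\<in>V. z v ^ ?b v) * f z)) = 0" by auto
  moreover have "(\<Prod>v\<in>V. z v ^ ?b v) = (\<Prod>v\<in>V. z v ^ b v) * z u" for z :: "'v \<Rightarrow> real"
  proof -
    have "(\<Prod>v\<in>V - {u}. z v ^ ?b v) = (\<Prod>v\<in>V - {u}. z v ^ b v)" by (rule prod.cong) auto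
    then show ?thesis by (simp add: split)
  qed
  ultimately show ?case by (simp add: mult.assoc)
qed

text \<open>A functional on the points that kills the reduced monomials, those with \<open>a v < p v\<close>,
  kills every polynomial: the relations rewrite any other monomial into lighter ones. Hence the
  evaluations at the points, which are independent, number at most as many as the reduced
  monomials.\<close>

lemma card_solutions_le:
  fixes X :: "('v \<Rightarrow> real) set"
  assumes V: "finite V" and X: "finite X"
    and ext: "\<And>y z. y \<in> X \<Longrightarrow> z \<in> X \<Longrightarrow> (\<And>v. v \<in> V \<Longrightarrow> y v = z v) \<Longrightarrow> y = z"
    and R: "\<And>v. v \<in> V \<Longrightarrow> wpoly V w (d v) (R v)"
    and lighter: "\<And>v. v \<in> V \<Longrightarrow> d v < p v * w v"
    and rel: "\<And>v z. v \<in> V \<Longrightarrow> z \<in> X \<Longrightarrow> z v ^ p v = R v z"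
  shows "card X \<le> (\<Prod>v\<in>V. p v)"
proof (rule ccontr)
  assume large: "\<not> card X \<le> (\<Prod>v\<in>V. p v)"
  \<comment> \<open>Exponent vectors of the reduced monomials. \<open>PiE\<close> fixes the values
    outside \<open>V\<close>, so their number is exactly the product of the
    \<open>p v\<close>.\<close>
  define E where "E = PiE V (\<lambda>v. {..<p v})"
  have "finite E" "card E < card X"
    using V large by (auto simp: E_def card_PiE intro: finite_PiE)
  then obtain c where c: "\<exists>z\<in>X. c z \<noteq> 0"
    "\<And>a. a \<in> E \<Longrightarrow> (\<Sum>z\<in>X. c z * (\<Prod>v\<in>V. z v ^ a v)) = 0"
    using homogeneous_system_nontrivial[OF _ X, of E "\<lambda>a z. \<Prod>v\<in>V. z v ^ a v"] by blast
  have mon: "(\<Sum>z\<in>X. c z * (\<Prod>v\<in>V. z v ^ a v)) = 0" for a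
  proof (induction "\<Sum>v\<in>V. a v * w v" arbitrary: a rule: less_induct)
    case less
    show ?case
    proof (cases "\<forall>v\<in>V. a v < p v")
      case True
      then have "restrict a V \<in> E" by (auto simp: E_def)
      from c(2)[OF this] show ?thesis by simp
    next
      case False
      then obtain u where u: "u \<in> V" "p u \<le> a u" by (auto simp: not_less)
      note split = sum.remove[OF V u(1)] prod.remove[OF V u(1)]
      let ?a = "a(u := a u - p u)"
      have "a u * w u = p u * w u + (a u - p u) * w u"
        using u(2) by (simp flip: add_mult_distrib)
      moreover have "(\<Sum>v\<in>V - {u}. ?a v * w v) = (\<Sum>v\<in>V - {u}. a v * w v)"
        by (rule sum.cong) auto
      ultimately have wt: "(\<Sum>v\<in>V. a v * w v) = (\<Sum>v\<in>V. ?a v * w v) + p u * w u"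
        by (simp add: split)
      have "(\<Sum>z\<in>X. c z * ((\<Prod>v\<in>V. z v ^ ?a v) * R u z)) = 0"
      proof (rule wpoly_functional_zero[OF V R[OF u(1)]])
        show "(\<Sum>v\<in>V. ?a v * w v) + d u \<le> (\<Sum>v\<in>V. a v * w v) - 1"
          using lighter[OF u(1)] wt by linarith
        show "(\<Sum>z\<in>X. c z * (\<Prod>v\<in>V. z v ^ a' v)) = 0"
          if "(\<Sum>v\<in>V. a' v * w v) \<le> (\<Sum>v\<in>V. a v * w v) - 1" for a'
          using less[of a'] that lighter[OF u(1)] wt by linarith
      qed
      moreover have "(\<Prod>v\<in>V. z v ^ a v) = (\<Prod>v\<in>V. z v ^ ?a v) * R u z" if "z \<in> X" for z
      proof -
        have "(\<Prod>v\<in>V - {u}. z v ^ ?a v) = (\<Prod>v\<in>V - {u}. z v ^ a v)" by (rule prod.cong) auto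
        moreover have "z u ^ a u = z u ^ (a u - p u) * R u z"
          using rel[OF u(1) that] u(2) by (metis le_add_diff_inverse2 power_add)
        ultimately show ?thesis by (simp add: split)
      qed
      ultimately show ?thesis by simp
    qed
  qed
  have kill: "(\<Sum>z\<in>X. c z * f z) = 0" if "wpoly V w d f" for d f
    using wpoly_functional_zero[OF V that, where X = X and c = c and b = "\<lambda>_. 0" and D = d] mon by simp
  obtain y where y: "y \<in> X" "c y \<noteq> 0" using c(1) by blast
  have "\<exists>v. v \<in> V \<and> z v \<noteq> y v" if "z \<in> X - {y}" for z
    using ext[of z y] that y by blast
  \<comment> \<open>\<open>s z\<close> is a coordinate separating \<open>z\<close> from
    \<open>y\<close>. The product of the differences vanishes on \<open>X\<close> except at
    \<open>y\<close>, so the functional takes the value \<open>c y * f y\<close> on it.\<close>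
  then obtain s where s: "\<And>z. z \<in> X - {y} \<Longrightarrow> s z \<in> V \<and> z (s z) \<noteq> y (s z)" by metis
  define f where "f = (\<lambda>x :: 'v \<Rightarrow> real. \<Prod>z\<in>X - {y}. x (s z) - z (s z))"
  have "wpoly V w (\<Sum>z\<in>X - {y}. w (s z)) f"
    unfolding f_def using s by (intro wpoly_prod wpoly_diff wpoly_var wpoly.const) auto
  then have "0 = (\<Sum>z\<in>X. c z * f z)" using kill by simp
  also have "\<dots> = c y * f y + (\<Sum>z\<in>X - {y}. c z * f z)" using X y by (rule_tac sum.remove)
  also have "(\<Sum>z\<in>X - {y}. c z * f z) = 0"
    using X by (intro sum.neutral) (auto simp: f_def)
  finally have "f y = 0" using y by simp
  moreover have "f y \<noteq> 0" using X s by (fastforce simp: f_def)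
  ultimately show False by blast
qed

section \<open>Critical points in cells\<close>

text \<open>A smoothing of \<open>ln g\<close> that is defined on the whole line, falls to \<open>-\<infinity>\<close> at \<open>g = 0\<close> as
  \<open>e \<rightarrow> 0\<close>, and whose derivative \<open>U\<close> is the positive root of the quadratic \<open>e U\<^sup>2 + g U = 1\<close>.\<close>

definition barrier :: "real \<Rightarrow> real \<Rightarrow> real" where
  "barrier e g = ln ((g + sqrt (g\<^sup>2 + 4 * e)) / 2) - 2 * e / (g + sqrt (g\<^sup>2 + 4 * e))\<^sup>2"

definition barrier_deriv :: "real \<Rightarrow> real \<Rightarrow> real" where
  "barrier_deriv e g = 2 / (g + sqrt (g\<^sup>2 + 4 * e))"

lemma add_sqrt_pos: "0 < e \<Longrightarrow> 0 < g + sqrt (g\<^sup>2 + 4 * e)" for e g :: real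
  using real_less_rsqrt[of "- g" "g\<^sup>2 + 4 * e"] by simp

text \<open>This makes the critical equations polynomial: the square-root expression becomes a slack
  variable subject to a quadratic equation.\<close>

lemma barrier_deriv_eq:
  assumes "0 < e"
  shows "e * (barrier_deriv e g)\<^sup>2 + barrier_deriv e g * g = 1"
proof -
  define s where "s = sqrt (g\<^sup>2 + 4 * e)"
  have s: "s\<^sup>2 = g\<^sup>2 + 4 * e" using assms by (simp add: s_def)
  define r where "r = g + s"
  have r: "r \<noteq> 0" using add_sqrt_pos[OF assms, of g] by (simp add: s_def r_def)
  then have "e * (2 / r)\<^sup>2 + 2 / r * g = (4 * e + 2 * g * r) / r\<^sup>2"
    by (simp add: field_simps power2_eq_square)
  also have "4 * e + 2 * g * r = r\<^sup>2"
    using s by (simp add: r_def power2_sum) (simp add: power2_eq_square algebra_simps)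
  finally show ?thesis using r by (simp add: barrier_deriv_def s_def r_def)
qed

text \<open>With \<open>s = sqrt (g\<^sup>2 + 4 * e)\<close> and \<open>r = g + s\<close>, the
  logarithm alone has derivative \<open>1 / s\<close>. The correction term adds
  \<open>4 * e / (s * r\<^sup>2)\<close>, and \<open>r\<^sup>2 + 4 * e = 2 * s * r\<close> turns the
  sum into \<open>2 / r\<close>.\<close>

lemma barrier_has_derivative:
  assumes "0 < e"
  shows "(barrier e has_real_derivative barrier_deriv e g) (at g)"
proof -
  define s where "s = sqrt (g\<^sup>2 + 4 * e)"
  have q: "0 < g\<^sup>2 + 4 * e" using assms by (smt (verit) zero_le_power2)
  then have s: "s\<^sup>2 = g\<^sup>2 + 4 * e" "0 < s" by (auto simp: s_def)
  define r where "r = g + s"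
  have r: "0 < r" using add_sqrt_pos[OF assms, of g] by (simp add: s_def r_def)
  have ds: "((\<lambda>g. g + sqrt (g\<^sup>2 + 4 * e)) has_real_derivative (r / s)) (at g)"
  proof -
    have "((\<lambda>g. g + sqrt (g\<^sup>2 + 4 * e)) has_real_derivative 1 + inverse s / 2 * (2 * g)) (at g)"
      unfolding s_def using q
      by (intro DERIV_add DERIV_ident DERIV_chain2[OF DERIV_real_sqrt])
         (auto intro!: derivative_eq_intros)
    moreover have "1 + inverse s / 2 * (2 * g) = r / s" using s(2) by (simp add: r_def field_simps)
    ultimately show ?thesis by simp
  qed
  have "((\<lambda>r. ln (r / 2) - 2 * e / r\<^sup>2) has_real_derivative (1 / r + 4 * e / r ^ 3)) (at r)"
    using r by (auto intro!: derivative_eq_intros simp: field_simps power2_eq_square power3_eq_cube)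
  then have "(barrier e has_real_derivative (1 / r + 4 * e / r ^ 3) * (r / s)) (at g)"
    unfolding barrier_def[abs_def] by (rule DERIV_chain2[OF _ ds, unfolded s_def[symmetric], folded r_def])
  also have "(1 / r + 4 * e / r ^ 3) * (r / s) = (r\<^sup>2 + 4 * e) / (s * r\<^sup>2)"
    using r s(2) by (simp add: field_simps power2_eq_square power3_eq_cube)
  also have "r\<^sup>2 + 4 * e = 2 * s * r"
    using s(1) by (simp add: r_def power2_sum) (simp add: power2_eq_square algebra_simps)
  also have "2 * s * r / (s * r\<^sup>2) = 2 / r" using r s(2) by (simp add: power2_eq_square)
  also have "\<dots> = barrier_deriv e g" by (simp add: barrier_deriv_def r_def s_def)
  finally show ?thesis .
qed

text \<open>The value on a wall \<open>g = 0\<close> drops below any bound as \<open>e\<close> tends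
  to 0; this keeps maximisers off the walls.\<close>

lemma barrier_0: "0 < e \<Longrightarrow> barrier e 0 = ln e / 2 - 1 / 2"
  by (simp add: barrier_def real_sqrt_mult ln_sqrt power_mult_distrib)

text \<open>Linear growth, uniformly in \<open>e\<close>, which the confining term can
  absorb.\<close>

lemma barrier_le:
  assumes "0 < e" "e \<le> 1" "0 \<le> g"
  shows "barrier e g \<le> g"
proof -
  define s where "s = sqrt (g\<^sup>2 + 4 * e)"
  have "g\<^sup>2 + 4 * e \<le> (g + 2)\<^sup>2" using assms by (simp add: power2_sum)
  then have "s \<le> g + 2" using assms by (simp add: s_def real_le_lsqrt)
  moreover have "barrier e g \<le> ln ((g + s) / 2)"
    using assms by (simp add: barrier_def s_def)
  moreover have "ln ((g + s) / 2) \<le> (g + s) / 2 - 1"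
    using add_sqrt_pos[OF assms(1), of g] by (intro ln_le_minus_one) (simp add: s_def)
  ultimately show ?thesis by argo
qed

text \<open>Uniform in \<open>e\<close>, so the objective at the base point of a cell stays bounded
  below while its values on the walls sink.\<close>

lemma barrier_ge:
  assumes "0 < e" "0 < g"
  shows "ln g - 1 / 2 \<le> barrier e g"
proof -
  define s where "s = sqrt (g\<^sup>2 + 4 * e)"
  have s2: "s\<^sup>2 = g\<^sup>2 + 4 * e" using assms by (simp add: s_def)
  have sg: "g \<le> s" using assms by (simp add: s_def real_le_rsqrt)
  have "ln g \<le> ln ((g + s) / 2)" using assms sg by simp
  moreover have "4 * e \<le> (g + s)\<^sup>2"
    using assms sg s2 by (simp add: power2_sum)
  then have "2 * e / (g + s)\<^sup>2 \<le> 1 / 2"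
    using assms sg by (simp add: divide_simps)
  ultimately show ?thesis by (simp add: barrier_def s_def)
qed

section \<open>Maximising the barrier inside a cell\<close>

lemma compact_box:
  "compact {x :: 'i \<Rightarrow> real. (\<forall>i. i \<notin> I \<longrightarrow> x i = 0) \<and> (\<forall>i\<in>I. \<bar>x i\<bar> \<le> R)}"
proof -
  \<comment> \<open>Tychonoff: points are functions on the whole index type, with a singleton factor
    for each coordinate outside \<open>I\<close>.\<close>
  have "compactin (product_topology (\<lambda>i::'i. euclidean) UNIV)
      (PiE UNIV (\<lambda>i. if i \<in> I then {-R..R} else {0}))"
    unfolding compactin_PiE by auto
  moreover have "PiE UNIV (\<lambda>i. if i \<in> I then {-R..R} else {0})
    = {x. (\<forall>i. i \<notin> I \<longrightarrow> x i = 0) \<and> (\<forall>i\<in>I. \<bar>x i\<bar> \<le> R)}"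
    by (auto simp: PiE_UNIV_domain Pi_iff abs_le_iff split: if_splits) (metis minus_le_iff)+
  ultimately show ?thesis by (simp add: euclidean_product_topology)
qed

text \<open>The confining term has larger degree than every \<open>g b\<close>, and only half of it
  is spent, so the other half still bounds the maximisers.\<close>

lemma sum_wpoly_growth:
  assumes "finite I" "\<And>b. b \<in> I \<Longrightarrow> wpoly I (\<lambda>_. 1) K (g b)"
  shows "\<exists>A. \<forall>x. (\<Sum>b\<in>I. \<bar>g b x\<bar>) \<le> A + (\<Sum>j\<in>I. x j ^ (2 * K + 2)) / 2"
proof -
  obtain a where a: "\<And>b x. b \<in> I \<Longrightarrow> \<bar>g b x\<bar> \<le> a b * (1 + (\<Sum>j\<in>I. \<bar>x j\<bar> ^ K))"
    using wpoly_growth[OF assms(1) assms(2)] by metis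
  define c where "c = (\<Sum>b\<in>I. a b)"
  \<comment> \<open>\<open>2 * c * s \<le> c\<^sup>2 + s\<^sup>2\<close> with
    \<open>s = \<bar>t\<bar> ^ K\<close>, then \<open>t ^ (2 * K)\<close> against
    \<open>1 + t ^ (2 * K + 2)\<close>.\<close>
  have tm: "c * \<bar>t\<bar> ^ K \<le> (c\<^sup>2 + 1) / 2 + t ^ (2 * K + 2) / 2" for t :: real
  proof -
    have "0 \<le> (c - \<bar>t\<bar> ^ K)\<^sup>2" by simp
    then have 1: "c * \<bar>t\<bar> ^ K \<le> c\<^sup>2 / 2 + (\<bar>t\<bar> ^ K)\<^sup>2 / 2" by (simp add: power2_diff)
    have "(t\<^sup>2) ^ K \<le> 1 + (t\<^sup>2) ^ Suc K"
    proof (cases "t\<^sup>2 \<le> 1")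
      case True
      then have "(t\<^sup>2) ^ K \<le> 1" by (rule power_le_one[OF zero_le_power2])
      also have "\<dots> \<le> 1 + (t\<^sup>2) ^ Suc K" by simp
      finally show ?thesis .
    next
      case False
      then have "(t\<^sup>2) ^ K \<le> (t\<^sup>2) ^ Suc K" by (intro power_increasing) auto
      then show ?thesis by linarith
    qed
    moreover have "(\<bar>t\<bar> ^ K)\<^sup>2 = (t\<^sup>2) ^ K" by (metis power2_abs power_commutes power_mult mult.commute)
    moreover have "(t\<^sup>2) ^ Suc K = t ^ (2 * K + 2)" by (subst power_mult[symmetric]) simp
    ultimately show ?thesis using 1 by argo
  qed
  have "(\<Sum>b\<in>I. \<bar>g b x\<bar>) \<le> (c + real (card I) * ((c\<^sup>2 + 1) / 2)) + (\<Sum>j\<in>I. x j ^ (2 * K + 2)) / 2" for x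
  proof -
    have "(\<Sum>b\<in>I. \<bar>g b x\<bar>) \<le> (\<Sum>b\<in>I. a b * (1 + (\<Sum>j\<in>I. \<bar>x j\<bar> ^ K)))" by (intro sum_mono a)
    also have "\<dots> = c * (1 + (\<Sum>j\<in>I. \<bar>x j\<bar> ^ K))" by (simp add: c_def sum_distrib_right)
    also have "\<dots> = c + (\<Sum>j\<in>I. c * \<bar>x j\<bar> ^ K)" by (simp add: algebra_simps sum_distrib_left)
    also have "\<dots> \<le> c + (\<Sum>j\<in>I. (c\<^sup>2 + 1) / 2 + x j ^ (2 * K + 2) / 2)"
      by (intro add_left_mono sum_mono tm)
    finally show ?thesis by (simp add: sum.distrib sum_divide_distrib)
  qed
  then show ?thesis by blast
qed

text \<open>The point maximises the sum of barriers minus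
  \<open>\<Sum>j\<in>I. x j ^ (2 * K + 2)\<close> on the part of \<open>C\<close> where no
  \<open>g b\<close> takes the sign opposite to that at \<open>p\<close>; \<open>u b\<close> is the
  derivative of the barrier with respect to \<open>g b\<close>. A whole interval of values
  \<open>e\<close> is provided so that many cells can share one.\<close>

lemma cell_critical_point:
  fixes g :: "'i \<Rightarrow> ('i \<Rightarrow> real) \<Rightarrow> real"
  assumes I: "finite I"
    and g: "\<And>b. b \<in> I \<Longrightarrow> wpoly I (\<lambda>_. 1) K (g b)"
    and g': "\<And>b j x. b \<in> I \<Longrightarrow> j \<in> I \<Longrightarrow>
      ((\<lambda>t. g b (x(j := t))) has_real_derivative g' b j x) (at (x j))"
    and C: "closed C" "p \<in> C" "\<And>i. i \<notin> I \<Longrightarrow> p i = 0" "\<And>b. b \<in> I \<Longrightarrow> g b p \<noteq> 0"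
    and interior: "\<And>x j. x \<in> C \<Longrightarrow> (\<And>b. b \<in> I \<Longrightarrow> g b x \<noteq> 0) \<Longrightarrow> j \<in> I \<Longrightarrow>
      \<forall>\<^sub>F t in at (x j). x(j := t) \<in> C"
  shows "\<exists>e0>0. \<forall>e. 0 < e \<longrightarrow> e < e0 \<longrightarrow> (\<exists>x u. x \<in> C \<and> (\<forall>i. i \<notin> I \<longrightarrow> x i = 0) \<and>
    (\<forall>b\<in>I. g b x \<noteq> 0) \<and> (\<forall>b\<in>I. e * (u b)\<^sup>2 + u b * g b x = 1) \<and>
    (\<forall>j\<in>I. real (2 * K + 2) * x j ^ (2 * K + 1) = (\<Sum>b\<in>I. u b * g' b j x)))"
proof -
  define sg where "sg b = sgn (g b p)" for b
  have sg: "sg b * sg b = 1" "\<bar>sg b\<bar> = 1" if "b \<in> I" for b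
    using C(4)[OF that] by (auto simp: sg_def sgn_if)
  define N where "N x = (\<Sum>j\<in>I. x j ^ (2 * K + 2))" for x :: "'i \<Rightarrow> real"
  have N_nonneg: "0 \<le> N x" for x unfolding N_def by (intro sum_nonneg zero_le_even_power) simp
  obtain A where A: "\<And>x. (\<Sum>b\<in>I. \<bar>g b x\<bar>) \<le> A + N x / 2"
    using sum_wpoly_growth[of I K g, OF I g] unfolding N_def by blast
  define C' where "C' = {x \<in> C. (\<forall>i. i \<notin> I \<longrightarrow> x i = 0) \<and> (\<forall>b\<in>I. 0 \<le> sg b * g b x)}"
  \<comment> \<open>\<open>L\<close> bounds the objective at \<open>p\<close> from below for every
    admissible \<open>e\<close>. \<open>R\<close> comes from \<open>N x \<le> 2 * (A - L)\<close>
    where the objective reaches \<open>L\<close>, and \<open>e0\<close> makes every wall value, at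
    most \<open>ln e / 2 + A\<close>, smaller than \<open>L\<close>.\<close>
  define L where "L = (\<Sum>b\<in>I. ln \<bar>g b p\<bar> - 1 / 2) - N p"
  define R where "R = 2 * \<bar>A - L\<bar> + 1"
  define e0 where "e0 = min 1 (exp (2 * (L - A)))"
  have sgp: "sg b * g b p = \<bar>g b p\<bar>" for b by (simp add: sg_def sgn_if)
  have pC': "p \<in> C'" using C(2,3) by (simp add: C'_def sgp)
  have cont_g: "continuous_on UNIV (g b)" if "b \<in> I" for b using g[OF that] by (rule wpoly_continuous)
  have "closed (C \<inter> (\<Inter>b\<in>I. {x. 0 \<le> sg b * g b x}))"
    using C(1) cont_g by (intro closed_Int closed_INT ballI closed_Collect_le continuous_intros) auto
  then have closed_C': "closed (C \<inter> {x. \<forall>b\<in>I. 0 \<le> sg b * g b x})"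
    by (simp add: Collect_ball_eq)
  have "\<exists>x u. x \<in> C \<and> (\<forall>i. i \<notin> I \<longrightarrow> x i = 0) \<and>
    (\<forall>b\<in>I. g b x \<noteq> 0) \<and> (\<forall>b\<in>I. e * (u b)\<^sup>2 + u b * g b x = 1) \<and>
    (\<forall>j\<in>I. real (2 * K + 2) * x j ^ (2 * K + 1) = (\<Sum>b\<in>I. u b * g' b j x))"
    if e: "0 < e" "e < e0" for e
  proof -
    have e1: "e \<le> 1" "ln e / 2 + A < L"
    proof -
      show "e \<le> 1" using e by (simp add: e0_def)
      have "ln e < 2 * (L - A)" using e by (metis e0_def exp_less_cancel_iff exp_ln min_less_iff_conj)
      then show "ln e / 2 + A < L" by simp
    qed
    define F where "F x = (\<Sum>b\<in>I. barrier e (sg b * g b x)) - N x" for x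
    have F_p: "L \<le> F p"
      unfolding F_def L_def sgp using C(4) e by (intro diff_right_mono sum_mono barrier_ge) auto
    have F_le: "F x \<le> A - N x / 2" if "x \<in> C'" for x
    proof -
      have "(\<Sum>b\<in>I. barrier e (sg b * g b x)) \<le> (\<Sum>b\<in>I. \<bar>g b x\<bar>)"
      proof (rule sum_mono)
        fix b assume b: "b \<in> I"
        then have "barrier e (sg b * g b x) \<le> sg b * g b x"
          using that e e1 by (intro barrier_le) (auto simp: C'_def)
        also have "\<dots> \<le> \<bar>g b x\<bar>" using sg(2)[OF b] by (metis abs_ge_self abs_mult mult_1)
        finally show "barrier e (sg b * g b x) \<le> \<bar>g b x\<bar>" .
      qed
      with A[of x] show ?thesis by (simp add: F_def)
    qed
    have in_box: "\<bar>x j\<bar> \<le> R" if "x \<in> C'" "L \<le> F x" "j \<in> I" for x j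
    proof (rule ccontr)
      assume "\<not> \<bar>x j\<bar> \<le> R"
      moreover have "1 \<le> R" by (simp add: R_def)
      ultimately have j: "R < \<bar>x j\<bar>" "1 \<le> \<bar>x j\<bar>" by auto
      have "\<bar>x j\<bar> ^ 1 \<le> \<bar>x j\<bar> ^ (2 * K + 2)" using j by (intro power_increasing) auto
      also have "\<bar>x j\<bar> ^ (2 * K + 2) = x j ^ (2 * K + 2)" by (simp add: power_even_abs)
      also have "\<dots> \<le> N x" unfolding N_def using that I by (intro member_le_sum zero_le_even_power) auto
      finally show False using j F_le[OF that(1)] that(2) by (simp add: R_def)
    qed
    define D where "D = C \<inter> {x. \<forall>b\<in>I. 0 \<le> sg b * g b x} \<inter>
      {x. (\<forall>i. i \<notin> I \<longrightarrow> x i = 0) \<and> (\<forall>i\<in>I. \<bar>x i\<bar> \<le> R)}"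
    have "compact D" unfolding D_def by (rule closed_Int_compact[OF closed_C' compact_box])
    have D_C': "D \<subseteq> C'" by (auto simp: D_def C'_def)
    have C'_D: "x \<in> D" if "x \<in> C'" "L \<le> F x" for x
      using that in_box[OF that] by (auto simp: D_def C'_def)
    have cont_B: "continuous_on UNIV (barrier e)"
      using barrier_has_derivative[OF e(1)] by (meson DERIV_isCont continuous_at_imp_continuous_on)
    have "continuous_on UNIV F"
      unfolding F_def N_def using cont_g
      by (intro continuous_intros continuous_on_compose2[OF cont_B]) auto
    then have "continuous_on D F" by (rule continuous_on_subset) simp
    moreover have "D \<noteq> {}" using C'_D[OF pC' F_p] by blast
    ultimately obtain x where x: "x \<in> D" "\<And>y. y \<in> D \<Longrightarrow> F y \<le> F x"
      using continuous_attains_sup[OF \<open>compact D\<close>] by metis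
    have L_x: "L \<le> F x" using F_p x(2)[OF C'_D[OF pC' F_p]] by simp
    \<comment> \<open>Points of \<open>C'\<close> outside \<open>D\<close> have \<open>F\<close>
      below \<open>L\<close>, so the maximum over the compact \<open>D\<close> is one over
      \<open>C'\<close>.\<close>
    have max: "F y \<le> F x" if "y \<in> C'" for y
      using x(2)[OF C'_D[OF that]] L_x by (cases "L \<le> F y") auto
    have xC': "x \<in> C'" using x(1) D_C' by blast
    \<comment> \<open>On a wall one barrier equals \<open>ln e / 2 - 1 / 2\<close> and the others
      sum to at most \<open>A + N x / 2\<close>, which puts \<open>F x\<close> below
      \<open>L\<close>.\<close>
    have nz: "g b x \<noteq> 0" if b: "b \<in> I" for b
    proof
      assume 0: "g b x = 0"
      have "(\<Sum>b\<in>I. barrier e (sg b * g b x))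
        = barrier e 0 + (\<Sum>b\<in>I - {b}. barrier e (sg b * g b x))"
        using 0 by (simp add: sum.remove[OF I b])
      also have "(\<Sum>b\<in>I - {b}. barrier e (sg b * g b x)) \<le> (\<Sum>b\<in>I - {b}. \<bar>g b x\<bar>)"
      proof (rule sum_mono)
        fix c assume c: "c \<in> I - {b}"
        then have "barrier e (sg c * g c x) \<le> sg c * g c x"
          using xC' e e1 by (intro barrier_le) (auto simp: C'_def)
        also have "\<dots> \<le> \<bar>g c x\<bar>" using sg(2)[of c] c by (metis DiffE abs_ge_self abs_mult mult_1)
        finally show "barrier e (sg c * g c x) \<le> \<bar>g c x\<bar>" .
      qed
      also have "\<dots> = (\<Sum>b\<in>I. \<bar>g b x\<bar>)" using 0 by (simp add: sum.remove[OF I b])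
      finally have "F x \<le> barrier e 0 + A - N x / 2" using A[of x] by (simp add: F_def)
      then show False using L_x e1(2) barrier_0[OF e(1)] N_nonneg[of x] by argo
    qed
    define u where "u b = sg b * barrier_deriv e (sg b * g b x)" for b
    have "e * (u b)\<^sup>2 + u b * g b x = 1" if "b \<in> I" for b
      using barrier_deriv_eq[OF e(1), of "sg b * g b x"] sg(1)[OF that]
      by (simp add: u_def power_mult_distrib power2_eq_square algebra_simps)
         (metis mult.assoc mult.left_commute mult_1)
    moreover have "real (2 * K + 2) * x j ^ (2 * K + 1) = (\<Sum>b\<in>I. u b * g' b j x)" if j: "j \<in> I" for j
    proof -
      let ?l = "(\<Sum>b\<in>I. u b * g' b j x) - real (2 * K + 2) * x j ^ (2 * K + 1)"
      have dB: "((\<lambda>t. barrier e (sg b * g b (x(j := t)))) has_real_derivative u b * g' b j x) (at (x j))"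
        if "b \<in> I" for b
        using DERIV_chain2[OF barrier_has_derivative[OF e(1)] DERIV_cmult[OF g'[OF that j, of x], of "sg b"]]
        by (simp add: u_def mult_ac)
      have dN: "((\<lambda>t. (x(j := t)) i ^ (2 * K + 2)) has_real_derivative
          (if i = j then real (2 * K + 2) * x j ^ (2 * K + 1) else 0)) (at (x j))" for i
        using DERIV_pow[of "2 * K + 2" "x j" UNIV] by (cases "i = j") simp_all
      have "((\<lambda>t. F (x(j := t))) has_real_derivative
          (\<Sum>b\<in>I. u b * g' b j x) - (\<Sum>i\<in>I. if i = j then real (2 * K + 2) * x j ^ (2 * K + 1) else 0))
        (at (x j))"
        unfolding F_def N_def by (intro DERIV_diff DERIV_sum dB dN)
      then have dF: "((\<lambda>t. F (x(j := t))) has_real_derivative ?l) (at (x j))"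
        using I j by simp
      \<comment> \<open>Moving one coordinate slightly stays in \<open>C'\<close>, so
        \<open>F\<close> has a local maximum along that line and its derivative vanishes.\<close>
      have "\<forall>\<^sub>F t in at (x j). 0 < sg b * g b (x(j := t))" if b: "b \<in> I" for b
      proof -
        have "0 < sg b * g b x" using xC' nz[OF b] sg(2)[OF b] b by (force simp: C'_def less_le)
        moreover have "((\<lambda>t. sg b * g b (x(j := t))) \<longlongrightarrow> sg b * g b (x(j := x j))) (at (x j))"
          using DERIV_isCont[OF DERIV_cmult[OF g'[OF b j, of x], of "sg b"]] unfolding isCont_def .
        ultimately show ?thesis by (simp add: order_tendstoD(1))
      qed
      then have "\<forall>\<^sub>F t in at (x j). \<forall>b\<in>I. 0 < sg b * g b (x(j := t))"
        using I by (intro eventually_ball_finite) auto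
      moreover have "\<forall>\<^sub>F t in at (x j). x(j := t) \<in> C"
        using xC' nz j by (intro interior) (auto simp: C'_def)
      ultimately have "\<forall>\<^sub>F t in at (x j). F (x(j := t)) \<le> F x"
      proof eventually_elim
        case (elim t)
        then have "x(j := t) \<in> C'" using xC' j by (auto simp: C'_def less_imp_le)
        then show ?case by (rule max)
      qed
      then obtain d where d: "0 < d" "\<And>t. t \<noteq> x j \<Longrightarrow> dist t (x j) < d \<Longrightarrow> F (x(j := t)) \<le> F x"
        unfolding eventually_at by blast
      have "\<forall>t. \<bar>x j - t\<bar> < d \<longrightarrow> F (x(j := t)) \<le> F (x(j := x j))"
        using d(2) by (metis abs_minus_commute dist_real_def fun_upd_triv order_refl)
      then have "?l = 0" using DERIV_local_max[OF dF d(1)] by blast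
      then show ?thesis by simp
    qed
    ultimately show ?thesis using xC' nz unfolding C'_def by blast
  qed
  moreover have "0 < e0" by (simp add: e0_def)
  ultimately show ?thesis by blast
qed

text \<open>With weight \<open>2\<close> for \<open>x\<close> and \<open>2K+1\<close> for the slack \<open>u\<close>, the critical equations express
  \<open>x\<^sub>j\<close> to the power \<open>2K+1\<close> and \<open>u\<^sub>b\<^sup>2\<close>, both of weight \<open>4K+2\<close>, by terms of weight at most \<open>4K+1\<close>.\<close>

lemma card_cells_le:
  fixes g :: "'i \<Rightarrow> ('i \<Rightarrow> real) \<Rightarrow> real" and C :: "'s \<Rightarrow> ('i \<Rightarrow> real) set"
  assumes I: "finite I" and S: "finite S"
    and g: "\<And>b. b \<in> I \<Longrightarrow> wpoly I (\<lambda>_. 1) K (g b)"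
    and C: "\<And>s. s \<in> S \<Longrightarrow> closed (C s)" "\<And>s. s \<in> S \<Longrightarrow> p s \<in> C s"
      "\<And>s i. s \<in> S \<Longrightarrow> i \<notin> I \<Longrightarrow> p s i = 0" "\<And>s b. s \<in> S \<Longrightarrow> b \<in> I \<Longrightarrow> g b (p s) \<noteq> 0"
    and interior: "\<And>s x j. s \<in> S \<Longrightarrow> x \<in> C s \<Longrightarrow> (\<And>b. b \<in> I \<Longrightarrow> g b x \<noteq> 0) \<Longrightarrow> j \<in> I \<Longrightarrow>
      \<forall>\<^sub>F t in at (x j). x(j := t) \<in> C s"
    and disjoint: "\<And>s s' x. s \<in> S \<Longrightarrow> s' \<in> S \<Longrightarrow> x \<in> C s \<Longrightarrow> x \<in> C s' \<Longrightarrow>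
      (\<And>b. b \<in> I \<Longrightarrow> g b x \<noteq> 0) \<Longrightarrow> s = s'"
  shows "card S \<le> (2 * (2 * K + 1)) ^ card I"
proof -
  have "\<exists>f'. wpoly I (\<lambda>_. 1) K f' \<and>
      (\<forall>x. ((\<lambda>t. g b (x(j := t))) has_real_derivative f' x) (at (x j)))" if "b \<in> I" for b j
    using wpoly_partial[OF g[OF that]] .
  then obtain g' where g': "\<And>b j. b \<in> I \<Longrightarrow> wpoly I (\<lambda>_. 1) K (g' b j)"
    "\<And>b j x. b \<in> I \<Longrightarrow> ((\<lambda>t. g b (x(j := t))) has_real_derivative g' b j x) (at (x j))"
    by metis
  define crit where "crit e s x u \<longleftrightarrow> x \<in> C s \<and> (\<forall>i. i \<notin> I \<longrightarrow> x i = 0) \<and>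
    (\<forall>b\<in>I. g b x \<noteq> 0) \<and> (\<forall>b\<in>I. e * (u b)\<^sup>2 + u b * g b x = 1) \<and>
    (\<forall>j\<in>I. real (2 * K + 2) * x j ^ (2 * K + 1) = (\<Sum>b\<in>I. u b * g' b j x))" for e s x u
  have "\<exists>e0>0. \<forall>e. 0 < e \<longrightarrow> e < e0 \<longrightarrow> (\<exists>x u. crit e s x u)" if s: "s \<in> S" for s
    unfolding crit_def
    using cell_critical_point[of I K g g' "C s" "p s", OF I g g'(2) C[OF s] interior[OF s]] .
  then obtain e0 where e0: "\<And>s. s \<in> S \<Longrightarrow> 0 < e0 s"
    "\<And>s e. s \<in> S \<Longrightarrow> 0 < e \<Longrightarrow> e < e0 s \<Longrightarrow> \<exists>x u. crit e s x u" by metis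
  \<comment> \<open>A single \<open>e\<close> puts the critical points of all cells into the same
    polynomial system. Halving gives strict inequality, and the inserted 1 covers an empty
    \<open>S\<close>.\<close>
  define e where "e = Min (insert 1 (e0 ` S)) / 2"
  have "0 < Min (insert 1 (e0 ` S))" using S e0(1) by (subst Min_gr_iff) auto
  moreover have "Min (insert 1 (e0 ` S)) \<le> e0 s" if "s \<in> S" for s
    using S that by (intro Min_le) auto
  ultimately have "0 < e" "\<And>s. s \<in> S \<Longrightarrow> e < e0 s" by (force simp: e_def)+
  then have "\<And>s. s \<in> S \<Longrightarrow> \<exists>x u. crit e s x u" using e0(2) by blast
  then obtain x u where xu: "\<And>s. s \<in> S \<Longrightarrow> crit e s (x s) (u s)" by metis
  \<comment> \<open>\<open>Inl\<close> carries parameters, \<open>Inr\<close> slacks. Slacks set to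
    0 outside \<open>I\<close> make each point determined by its values on
    \<open>?V\<close>.\<close>
  define z where "z s = case_sum (x s) (\<lambda>b. if b \<in> I then u s b else 0)" for s
  let ?V = "I <+> I"
  define w :: "'i + 'i \<Rightarrow> nat" where "w = case_sum (\<lambda>_. 2) (\<lambda>_. 2 * K + 1)"
  define q :: "'i + 'i \<Rightarrow> nat" where "q = case_sum (\<lambda>_. 2 * K + 1) (\<lambda>_. 2)"
  define R :: "'i + 'i \<Rightarrow> ('i + 'i \<Rightarrow> real) \<Rightarrow> real" where
    "R = case_sum (\<lambda>j y. 1 / real (2 * K + 2) * (\<Sum>b\<in>I. y (Inr b) * g' b j (\<lambda>i. y (Inl i))))
      (\<lambda>b y. 1 / e * (1 - y (Inr b) * g b (\<lambda>i. y (Inl i))))"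
  have lift: "wpoly ?V w (2 * K) (\<lambda>y. f (\<lambda>i. y (Inl i)))" if "wpoly I (\<lambda>_. 1) K f" for f
  proof (rule wpoly_reindex[where V = I and w = "\<lambda>_. 2" and f = f and h = Inl])
    show "wpoly I (\<lambda>_. 2) (2 * K) f" using wpoly_weights[OF that] by simp
  qed (auto simp: w_def)
  \<comment> \<open>A slack of weight \<open>2 * K + 1\<close> times a lifted polynomial of weight
    at most \<open>2 * K\<close> gives \<open>4 * K + 1\<close>.\<close>
  have R: "wpoly ?V w (4 * K + 1) (R v)" if "v \<in> ?V" for v
  proof (cases v)
    case (Inl j)
    show ?thesis unfolding R_def Inl sum.case
      using that Inl
      by (intro wpoly_cmult wpoly_sum wpoly.var_mult[OF lift[OF g'(1)]]) (auto simp: w_def)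
  next
    case (Inr b)
    show ?thesis unfolding R_def Inr sum.case
      using that Inr
      by (intro wpoly_cmult wpoly_diff wpoly.const wpoly.var_mult[OF lift[OF g]]) (auto simp: w_def)
  qed
  \<comment> \<open>The parameter part of \<open>z s\<close> lies in \<open>C s\<close> off the
    walls, where the cells are disjoint.\<close>
  have inj: "inj_on z S"
  proof (rule inj_onI)
    fix s s' assume s: "s \<in> S" "s' \<in> S" "z s = z s'"
    then have "x s = x s'" by (metis z_def case_sum_o_inj(1))
    then show "s = s'" using disjoint[OF s(1,2), of "x s"] xu[OF s(1)] xu[OF s(2)] by (auto simp: crit_def)
  qed
  have "card (z ` S) \<le> (\<Prod>v\<in>?V. q v)"
  proof (rule card_solutions_le)
    show "finite ?V" "finite (z ` S)" using I S by auto
    show "y = y'" if yy: "y \<in> z ` S" "y' \<in> z ` S" "\<And>v. v \<in> ?V \<Longrightarrow> y v = y' v" for y y'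
    proof
      fix v
      show "y v = y' v"
      proof (cases "v \<in> ?V")
        case False
        have "z s v = 0" if "s \<in> S" for s
          using False xu[OF that] by (cases v) (auto simp: z_def crit_def)
        with yy show ?thesis by auto
      qed (fact yy(3))
    qed
    show "wpoly ?V w (4 * K + 1) (R v)" if "v \<in> ?V" for v by (rule R[OF that])
    show "4 * K + 1 < q v * w v" for v by (cases v) (auto simp: q_def w_def)
    show "y v ^ q v = R v y" if vy: "v \<in> ?V" "y \<in> z ` S" for v y
    proof -
      obtain s where s: "s \<in> S" "y = z s" using vy(2) by blast
      have [simp]: "(\<lambda>i. z s (Inl i)) = x s" by (simp add: z_def)
      show ?thesis
      proof (cases v)
        case (Inl j)
        with vy(1) have j: "j \<in> I" by auto
        have "(\<Sum>b\<in>I. z s (Inr b) * g' b j (x s)) = (\<Sum>b\<in>I. u s b * g' b j (x s))"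
          by (intro sum.cong) (auto simp: z_def)
        also have "\<dots> = real (2 * K + 2) * x s j ^ (2 * K + 1)" using xu[OF s(1)] j by (simp add: crit_def)
        finally show ?thesis using Inl by (simp add: s(2) q_def R_def) (simp add: z_def field_simps)
      next
        case (Inr b)
        with vy(1) have b: "b \<in> I" by auto
        have "e * (u s b)\<^sup>2 = 1 - u s b * g b (x s)" using xu[OF s(1)] b by (simp add: crit_def algebra_simps)
        then show ?thesis using Inr b \<open>0 < e\<close> by (simp add: s(2) q_def R_def) (simp add: z_def field_simps)
      qed
    qed
  qed
  also have "card (z ` S) = card S" using inj by (rule card_image)
  also have "(\<Prod>v\<in>?V. q v) = (2 * K + 1) ^ card I * 2 ^ card I"
    using I by (simp add: prod.Plus q_def)
  also have "\<dots> = (2 * (2 * K + 1)) ^ card I" by (subst power_mult_distrib) (rule mult.commute)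
  finally show ?thesis .
qed

section \<open>Positive definite matrices\<close>

lemma quadratic_form_sum: "v \<bullet> (A *v v) = (\<Sum>i\<in>UNIV. v $ i * (\<Sum>j\<in>UNIV. A $ i $ j * v $ j))"
  for A :: "real^'n^'n"
  by (simp add: inner_vec_def matrix_vector_mult_def)

text \<open>Moving a null vector \<open>v\<close> of the form in the direction \<open>A *v v\<close>
  changes the form to first order, so semidefiniteness forces \<open>A *v v = 0\<close>, which
  invertibility excludes.\<close>

lemma psd_imp_pos_def:
  fixes A :: "real^'n^'n"
  assumes sym: "sym_mat A" and psd: "\<And>v. 0 \<le> v \<bullet> (A *v v)" and det: "det A \<noteq> 0"
  shows "pos_def A"
  unfolding pos_def_def
proof (intro conjI allI impI sym)
  fix v :: "real^'n" assume v: "v \<noteq> 0"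
  show "0 < v \<bullet> (A *v v)"
  proof (rule ccontr)
    assume "\<not> 0 < v \<bullet> (A *v v)"
    with psd[of v] have v0: "v \<bullet> (A *v v) = 0" by simp
    define w where "w = A *v v"
    define a where "a = w \<bullet> w"
    define c where "c = w \<bullet> (A *v w)"
    have vw: "v \<bullet> (A *v w) = a"
      by (metis a_def w_def dot_lmul_matrix sym sym_mat_def vector_transpose_matrix)
    have "0 \<le> 2 * t * a + t\<^sup>2 * c" for t
    proof -
      have "(v + t *\<^sub>R w) \<bullet> (A *v (v + t *\<^sub>R w))
        = v \<bullet> (A *v v) + t * (v \<bullet> (A *v w)) + t * (w \<bullet> (A *v v)) + t\<^sup>2 * (w \<bullet> (A *v w))"
        by (simp add: matrix_vector_right_distrib matrix_vector_mult_scaleR inner_add_left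
            inner_add_right algebra_simps power2_eq_square)
      also have "\<dots> = 2 * t * a + t\<^sup>2 * c" using v0 vw by (simp add: a_def c_def w_def)
      finally show ?thesis using psd[of "v + t *\<^sub>R w"] by simp
    qed
    note nonneg = this
    have c: "0 \<le> c" unfolding c_def by (rule psd)
    \<comment> \<open>The denominator \<open>c + 1\<close> covers \<open>c = 0\<close>; the
      quadratic becomes \<open>- a\<^sup>2 * (c + 2) / (c + 1)\<^sup>2\<close>, negative unless
      \<open>a = 0\<close>.\<close>
    define t where "t = - a / (c + 1)"
    have t: "t * (c + 1) = - a" using c by (simp add: t_def)
    have "0 \<le> (2 * t * a + t\<^sup>2 * c) * (c + 1)\<^sup>2" using nonneg[of t] by simp
    also have "\<dots> = 2 * (t * (c + 1)) * a * (c + 1) + (t * (c + 1))\<^sup>2 * c"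
      by (simp add: algebra_simps power2_eq_square)
    also have "\<dots> = - (a\<^sup>2 * (c + 2))" unfolding t by (simp add: algebra_simps power2_eq_square)
    finally have "a = 0" using c by (simp add: mult_le_0_iff)
    then have "A *v v = 0" by (simp add: a_def w_def)
    moreover have "invertible A" using det by (simp add: invertible_det_nz)
    ultimately show False using v
      by (metis invertible_left_inverse matrix_left_invertible_ker)
  qed
qed

section \<open>Topology of definite matrices and spectral shifts\<close>

lemma closed_psd: "closed {A :: real^'n^'n. \<forall>v. 0 \<le> v \<bullet> (A *v v)}"
  unfolding quadratic_form_sum
  by (intro closed_Collect_all closed_Collect_le continuous_intros)

lemma pos_def_iff_sphere:
  "sym_mat A \<Longrightarrow> pos_def A \<longleftrightarrow> (\<forall>v\<in>sphere 0 1. 0 < v \<bullet> (A *v v))"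
proof (rule iffI)
  assume "sym_mat A" and pos: "\<forall>v\<in>sphere 0 1. 0 < v \<bullet> (A *v v)"
  have "0 < v \<bullet> (A *v v)" if "v \<noteq> 0" for v
  proof -
    have "sgn v \<in> sphere 0 1" using that by (simp add: norm_sgn)
    with pos have "0 < sgn v \<bullet> (A *v sgn v)" by blast
    then show ?thesis
      using that by (simp add: sgn_div_norm matrix_vector_mult_scaleR zero_less_mult_iff zero_less_divide_iff)
  qed
  then show "pos_def A" using \<open>sym_mat A\<close> by (simp add: pos_def_def)
qed (metis dist_0_norm mem_sphere norm_zero pos_def_def zero_neq_one)

text \<open>The complement is the projection of a closed set along the compact sphere.\<close>

lemma open_pos_sphere: "open {A :: real^'n^'n. \<forall>v\<in>sphere 0 1. 0 < v \<bullet> (A *v v)}"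
proof -
  have "closed {z :: (real^'n) \<times> (real^'n^'n). fst z \<bullet> (snd z *v fst z) \<le> 0}"
    unfolding quadratic_form_sum by (intro closed_Collect_le continuous_intros)
  from closed_compact_projection[OF compact_sphere[of 0 1] this]
  have "closed {A :: real^'n^'n. \<exists>v. v \<in> sphere 0 1 \<and> v \<bullet> (A *v v) \<le> 0}" by simp
  then have "open (- {A :: real^'n^'n. \<exists>v. v \<in> sphere 0 1 \<and> v \<bullet> (A *v v) \<le> 0})" by (rule open_Compl)
  also have "- {A :: real^'n^'n. \<exists>v. v \<in> sphere 0 1 \<and> v \<bullet> (A *v v) \<le> 0}
    = {A. \<forall>v\<in>sphere 0 1. 0 < v \<bullet> (A *v v)}" by (simp only: Compl_eq mem_Collect_eq) (meson not_le)
  finally show ?thesis .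
qed

lemma sym_mat_shift: "sym_mat A \<Longrightarrow> sym_mat (A - d *\<^sub>R mat 1)" for A :: "real^'n^'n"
  by (simp add: sym_mat_def transpose_def mat_def vec_eq_iff)

lemma shift_mult: "(A - d *\<^sub>R mat 1) *v v = A *v v - d *\<^sub>R v" for A :: "real^'n^'n"
  by (simp add: matrix_vector_mult_diff_rdistrib scaleR_matrix_vector_assoc[symmetric])

text \<open>Eigenvectors of a symmetric matrix for distinct eigenvalues are orthogonal, and only
  finitely many fit into a finite-dimensional space.\<close>

lemma finite_eigenvalues:
  fixes A :: "real^'n^'n"
  assumes "sym_mat A"
  shows "finite {d. det (A - d *\<^sub>R mat 1) = 0}"
proof -
  let ?D = "{d. det (A - d *\<^sub>R mat 1) = 0}"
  have "\<exists>v. v \<noteq> 0 \<and> A *v v = d *\<^sub>R v" if "d \<in> ?D" for d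
  proof -
    have "\<not> invertible (A - d *\<^sub>R mat 1)" using that by (simp add: invertible_det_nz)
    then obtain v where "v \<noteq> 0" "(A - d *\<^sub>R mat 1) *v v = 0"
      by (metis invertible_left_inverse matrix_left_invertible_ker)
    then show ?thesis by (auto simp: shift_mult)
  qed
  then obtain v where v: "\<And>d. d \<in> ?D \<Longrightarrow> v d \<noteq> 0" "\<And>d. d \<in> ?D \<Longrightarrow> A *v v d = d *\<^sub>R v d"
    by metis
  have orth: "v d \<bullet> v d' = 0" if "d \<in> ?D" "d' \<in> ?D" "d \<noteq> d'" for d d'
  proof -
    have "v d \<bullet> (A *v v d') = (A *v v d) \<bullet> v d'"
      by (metis assms dot_lmul_matrix sym_mat_def vector_transpose_matrix)
    then have "(d' - d) * (v d \<bullet> v d') = 0"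
      using v(2)[OF that(1)] v(2)[OF that(2)] by (simp add: algebra_simps)
    with that show ?thesis by simp
  qed
  have "inj_on v ?D"
  proof (rule inj_onI, rule ccontr)
    fix d d' assume "d \<in> ?D" "d' \<in> ?D" "v d = v d'" "d \<noteq> d'"
    with orth[of d d'] v(1)[of d] show False by simp
  qed
  moreover have "finite (v ` ?D)"
    by (rule pairwise_orthogonal_imp_finite) (auto simp: pairwise_def orthogonal_def intro: orth)
  ultimately show ?thesis by (metis finite_imageD)
qed

section \<open>Shattering by definiteness of polynomial matrices\<close>

text \<open>Greedy: one group takes up to \<open>r\<close> points, and what is left fits into the
  others.\<close>

lemma partition_into_groups:
  assumes "finite I" "finite S" "card S \<le> r * card I"
  shows "\<exists>h. (\<forall>q\<in>S. h q \<in> I) \<and> (\<forall>b\<in>I. card {q \<in> S. h q = b} \<le> r)"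
  using assms
proof (induction I arbitrary: S rule: finite_induct)
  case (insert b I)
  obtain S' where S': "S' \<subseteq> S" "card S' = min r (card S)" "finite S'"
    using obtain_subset_with_card_n[of "min r (card S)" S] by auto
  have "card (S - S') \<le> r * card I"
    using S' insert by (simp add: card_Diff_subset)
  then obtain h where h: "\<And>q. q \<in> S - S' \<Longrightarrow> h q \<in> I" "\<And>b. b \<in> I \<Longrightarrow> card {q \<in> S - S'. h q = b} \<le> r"
    using insert.IH[of "S - S'"] insert.prems by auto
  define h' where "h' q = (if q \<in> S' then b else h q)" for q
  have "{q \<in> S. h' q = b} = S'" using S'(1) h(1) insert.hyps(2) by (auto simp: h'_def)
  moreover have "{q \<in> S. h' q = c} = {q \<in> S - S'. h q = c}" if "c \<in> I" for c
    using insert.hyps(2) that by (auto simp: h'_def)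
  ultimately have "card {q \<in> S. h' q = c} \<le> r" if "c \<in> insert b I" for c
    using that h(2) S'(2) by auto
  moreover have "h' q \<in> insert b I" if "q \<in> S" for q using that h(1) by (auto simp: h'_def)
  ultimately show ?case by blast
qed simp

lemma wpoly_det:
  fixes A :: "('i \<Rightarrow> real) \<Rightarrow> real^'n^'n"
  assumes "\<And>i j. wpoly V w d (\<lambda>x. A x $ i $ j)"
  shows "wpoly V w (d * CARD('n)) (\<lambda>x. det (A x))"
proof -
  have "wpoly V w (\<Sum>i\<in>(UNIV :: 'n set). d) (\<lambda>x. \<Prod>i\<in>UNIV. A x $ i $ s i)" for s
    by (intro wpoly_prod assms)
  then show ?thesis unfolding det_def by (intro wpoly_sum wpoly_cmult) (simp add: mult.commute)
qed

lemma eventually_at_right_0_notin: "finite B \<Longrightarrow> \<forall>\<^sub>F d in at_right (0::real). d \<notin> B"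
proof -
  assume "finite B"
  \<comment> \<open>0 is taken out of \<open>B\<close>, as it may itself be an eigenvalue; the
    right-hand limit never visits it.\<close>
  then have "\<forall>\<^sub>F d in nhds 0. d \<in> - (B - {0})"
    by (intro eventually_nhds_in_open open_Compl finite_imp_closed) auto
  then show ?thesis by (auto simp: eventually_at_filter elim: eventually_mono)
qed

text \<open>The points are split into \<open>card I\<close> groups. The product of the determinants over each group
  separates the cells, and the shift by \<open>d\<close> makes all determinants nonzero at the given parameters.\<close>

lemma shattered_power_le:
  fixes M :: "'q \<Rightarrow> ('i \<Rightarrow> real) \<Rightarrow> real^'n^'n"
  assumes I: "finite I" and S: "finite S" "card S \<le> r * card I"
    and poly: "\<And>q i j. q \<in> S \<Longrightarrow> wpoly I (\<lambda>_. 1) k (\<lambda>x. M q x $ i $ j)"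
    and sym: "\<And>q x. q \<in> S \<Longrightarrow> sym_mat (M q x)"
    and shat: "\<And>T. T \<subseteq> S \<Longrightarrow> \<exists>x. (\<forall>i. i \<notin> I \<longrightarrow> x i = 0) \<and> {q \<in> S. \<not> pos_def (M q x)} = T"
  shows "2 ^ card S \<le> (2 * (2 * (r * (k * CARD('n))) + 1)) ^ card I"
proof -
  obtain P where P: "\<And>T i. T \<subseteq> S \<Longrightarrow> i \<notin> I \<Longrightarrow> P T i = 0"
    "\<And>T. T \<subseteq> S \<Longrightarrow> {q \<in> S. \<not> pos_def (M q (P T))} = T"
    using shat by metis
  obtain h where h: "\<And>q. q \<in> S \<Longrightarrow> h q \<in> I" "\<And>b. b \<in> I \<Longrightarrow> card {q \<in> S. h q = b} \<le> r"
    using partition_into_groups[OF I S] by blast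
  let ?pos = "{A :: real^'n^'n. \<forall>v\<in>sphere 0 1. 0 < v \<bullet> (A *v v)}"
  let ?psd = "{A :: real^'n^'n. \<forall>v. 0 \<le> v \<bullet> (A *v v)}"
  \<comment> \<open>Positive definiteness survives a small shift because it is an open condition;
    its failure will survive because the shift lowers the form.\<close>
  have "\<forall>\<^sub>F d in at_right 0. det (M q (P T) - d *\<^sub>R mat 1) \<noteq> 0 \<and>
      (pos_def (M q (P T)) \<longrightarrow> pos_def (M q (P T) - d *\<^sub>R mat 1))" if q: "q \<in> S" for q T
  proof -
    let ?A = "M q (P T)"
    have "\<forall>\<^sub>F d in at_right 0. d \<notin> {d. det (?A - d *\<^sub>R mat 1) = 0}"
      by (intro eventually_at_right_0_notin finite_eigenvalues sym q)
    moreover have "\<forall>\<^sub>F d in at_right 0. pos_def ?A \<longrightarrow> pos_def (?A - d *\<^sub>R mat 1)"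
    proof (cases "pos_def ?A")
      case True
      then have "?A \<in> ?pos" using pos_def_iff_sphere[OF sym[OF q]] by blast
      moreover have "((\<lambda>d. ?A - d *\<^sub>R mat 1) \<longlongrightarrow> ?A - 0 *\<^sub>R mat 1) (at_right 0)"
        by (intro tendsto_intros)
      ultimately have "\<forall>\<^sub>F d in at_right 0. ?A - d *\<^sub>R mat 1 \<in> ?pos"
        using topological_tendstoD[OF _ open_pos_sphere] by simp
      then show ?thesis
        using pos_def_iff_sphere[OF sym_mat_shift[OF sym[OF q]]] by (auto elim: eventually_mono)
    qed simp
    ultimately show ?thesis by eventually_elim auto
  qed
  then have "\<forall>\<^sub>F d in at_right 0. \<forall>T\<in>Pow S. \<forall>q\<in>S. det (M q (P T) - d *\<^sub>R mat 1) \<noteq> 0 \<and>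
      (pos_def (M q (P T)) \<longrightarrow> pos_def (M q (P T) - d *\<^sub>R mat 1))"
    using S(1) by (intro eventually_ball_finite ballI) auto
  with eventually_at_right_less[of 0]
  have "\<forall>\<^sub>F d in at_right 0. 0 < d \<and> (\<forall>T\<in>Pow S. \<forall>q\<in>S. det (M q (P T) - d *\<^sub>R mat 1) \<noteq> 0 \<and>
      (pos_def (M q (P T)) \<longrightarrow> pos_def (M q (P T) - d *\<^sub>R mat 1)))" by eventually_elim blast
  then obtain d where d: "0 < d"
    "\<And>T q. T \<subseteq> S \<Longrightarrow> q \<in> S \<Longrightarrow> det (M q (P T) - d *\<^sub>R mat 1) \<noteq> 0"
    "\<And>T q. T \<subseteq> S \<Longrightarrow> q \<in> S \<Longrightarrow> pos_def (M q (P T)) \<Longrightarrow> pos_def (M q (P T) - d *\<^sub>R mat 1)"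
    using eventually_happens'[OF trivial_limit_at_right_real] by blast
  define D where "D q x = M q x - d *\<^sub>R mat 1" for q x
  have symD: "sym_mat (D q x)" if "q \<in> S" for q x unfolding D_def by (intro sym_mat_shift sym that)
  have pos_iff: "pos_def (D q x) \<longleftrightarrow> D q x \<in> ?pos" if "q \<in> S" for q x
    using pos_def_iff_sphere[OF symD[OF that]] by simp
  have pos_psd: "A \<in> ?psd" if "pos_def A" for A :: "real^'n^'n"
  proof -
    have "0 \<le> v \<bullet> (A *v v)" for v
      using that by (cases "v = 0") (auto simp: pos_def_def intro: less_imp_le)
    then show ?thesis by simp
  qed
  have psd_pos: "pos_def (D q x)" if "q \<in> S" "D q x \<in> ?psd" "det (D q x) \<noteq> 0" for q x
    using psd_imp_pos_def[OF symD[OF that(1)] _ that(3)] that(2) by blast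
  \<comment> \<open>Both alternatives are closed, and a symmetric matrix meeting both is singular.
    Away from the zeros of the determinants the cells are therefore open and disjoint.\<close>
  define C where "C T = (\<Inter>q\<in>S. D q -` (if q \<in> T then - ?pos else ?psd))" for T
  have C_iff: "x \<in> C T \<longleftrightarrow> (\<forall>q\<in>S. if q \<in> T then \<not> pos_def (D q x) else D q x \<in> ?psd)" for x T
    using pos_iff by (auto simp: C_def split: if_splits)
  define g where "g b x = (\<Prod>q\<in>{q \<in> S. h q = b}. det (D q x))" for b x
  have nonzero: "det (D q x) \<noteq> 0" if "\<And>b. b \<in> I \<Longrightarrow> g b x \<noteq> 0" "q \<in> S" for q x
    using that(1)[OF h(1)[OF that(2)]] that(2) S(1) by (auto simp: g_def)
  have poly_D: "wpoly I (\<lambda>_. 1) k (\<lambda>x. D q x $ i $ j)" if "q \<in> S" for q i j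
    using wpoly_diff[OF poly[OF that, of i j] wpoly.const[of _ _ _ "(d *\<^sub>R mat 1 :: real^'n^'n) $ i $ j"]]
    by (simp add: D_def)
  have poly_g: "wpoly I (\<lambda>_. 1) (r * (k * CARD('n))) (g b)" if "b \<in> I" for b
  proof (rule wpoly_mono)
    show "wpoly I (\<lambda>_. 1) (\<Sum>q\<in>{q \<in> S. h q = b}. k * CARD('n)) (g b)"
      unfolding g_def[abs_def] by (intro wpoly_prod wpoly_det poly_D) simp
    show "(\<Sum>q\<in>{q \<in> S. h q = b}. k * CARD('n)) \<le> r * (k * CARD('n))"
      using h(2)[OF that] by (simp only: sum_constant of_nat_id mult_le_mono1)
  qed
  have cont: "continuous_on UNIV (D q)" if "q \<in> S" for q
  proof -
    have "continuous_on UNIV (\<lambda>x. \<chi> i j. D q x $ i $ j)"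
      by (intro continuous_on_vec_lambda wpoly_continuous[OF poly_D[OF that]])
    then show ?thesis by simp
  qed
  have lim: "\<forall>\<^sub>F t in at (x j). D q (x(j := t)) \<in> U" if "q \<in> S" "open U" "D q x \<in> U" for q x j U
  proof -
    have "continuous_on UNIV (\<lambda>t. x(j := t))"
    proof (rule continuous_on_coordinatewise_then_product)
      show "continuous_on UNIV (\<lambda>t. (x(j := t)) i)" for i by (cases "i = j") auto
    qed
    then have "continuous_on UNIV (\<lambda>t. D q (x(j := t)))"
      by (intro continuous_on_compose2[OF cont[OF that(1)]]) auto
    then have "((\<lambda>t. D q (x(j := t))) \<longlongrightarrow> D q (x(j := x j))) (at (x j))"
      by (simp only: continuous_on_eq_continuous_at[OF open_UNIV] isCont_def) blast
    then show ?thesis using topological_tendstoD[OF _ that(2)] that(3) by (metis fun_upd_triv)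
  qed
  have "card (Pow S) \<le> (2 * (2 * (r * (k * CARD('n))) + 1)) ^ card I"
  proof (rule card_cells_le[where g = g and C = C and p = P])
    show "wpoly I (\<lambda>_. 1) (r * (k * CARD('n))) (g b)" if "b \<in> I" for b by (rule poly_g[OF that])
    show "closed (C T)" for T
      unfolding C_def
    proof (intro closed_INT ballI closed_vimage)
      show "closed (if q \<in> T then - ?pos else ?psd)" for q
        using open_pos_sphere closed_psd by (auto simp: closed_def)
    qed (rule cont)
    show "P T \<in> C T" if "T \<in> Pow S" for T
      unfolding C_iff
    proof
      fix q assume q: "q \<in> S"
      show "if q \<in> T then \<not> pos_def (D q (P T)) else D q (P T) \<in> ?psd"
      proof (cases "q \<in> T")
        case True
        then have "\<not> pos_def (M q (P T))" using P(2)[of T] that by blast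
        then obtain v where v: "v \<noteq> 0" "v \<bullet> (M q (P T) *v v) \<le> 0"
          using sym[OF q] by (auto simp: pos_def_def not_less)
        have "v \<bullet> (D q (P T) *v v) = v \<bullet> (M q (P T) *v v) - d * (v \<bullet> v)"
          by (simp add: D_def shift_mult inner_diff_right)
        also have "\<dots> \<le> 0" using v d(1) by (smt (verit) inner_ge_zero mult_nonneg_nonneg)
        finally show ?thesis using True v(1) by (auto simp: pos_def_def not_less)
      next
        case False
        then have "pos_def (M q (P T))" using P(2)[of T] that q by blast
        then have "pos_def (D q (P T))" using d(3)[of T q] that q by (simp add: D_def)
        then show ?thesis using False pos_psd by auto
      qed
    qed
    show "P T i = 0" if "T \<in> Pow S" "i \<notin> I" for T i using P(1) that by blast
    show "g b (P T) \<noteq> 0" if "T \<in> Pow S" for T b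
      using d(2)[of T] that S(1) by (auto simp: g_def D_def)
    show "\<forall>\<^sub>F t in at (x j). x(j := t) \<in> C T"
      if "x \<in> C T" and nz: "\<And>b. b \<in> I \<Longrightarrow> g b x \<noteq> 0" for T x j
    proof -
      have "\<forall>\<^sub>F t in at (x j). if q \<in> T then \<not> pos_def (D q (x(j := t))) else D q (x(j := t)) \<in> ?psd"
        if q: "q \<in> S" for q
      proof (cases "q \<in> T")
        case True
        \<comment> \<open>With nonzero determinant, not positive definite means not semidefinite,
          which is an open condition.\<close>
        then have "D q x \<in> - ?psd"
          using \<open>x \<in> C T\<close> q psd_pos nonzero[OF nz q] unfolding C_iff by fastforce
        from lim[OF q open_Compl[OF closed_psd] this] show ?thesis
        proof eventually_elim
          case (elim t)
          then show ?case using True pos_psd[of "D q (x(j := t))"] by auto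
        qed
      next
        case False
        then have "pos_def (D q x)"
          using \<open>x \<in> C T\<close> q psd_pos nonzero[OF nz q] unfolding C_iff by fastforce
        then have "D q x \<in> ?pos" using pos_iff[OF q] by blast
        from lim[OF q open_pos_sphere this] show ?thesis
        proof eventually_elim
          case (elim t)
          then show ?case using False pos_psd pos_iff[OF q] by auto
        qed
      qed
      then show ?thesis unfolding C_iff using S(1) by (intro eventually_ball_finite) auto
    qed
    show "T = T'"
      if TT': "T \<in> Pow S" "T' \<in> Pow S" "x \<in> C T" "x \<in> C T'"
        and nz: "\<And>b. b \<in> I \<Longrightarrow> g b x \<noteq> 0" for T T' x
    proof -
      have "U = {q \<in> S. \<not> pos_def (D q x)}" if U: "U \<in> Pow S" "x \<in> C U" for U
      proof -
        have "q \<in> U \<longleftrightarrow> \<not> pos_def (D q x)" if q: "q \<in> S" for q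
        proof (cases "q \<in> U")
          case True
          then show ?thesis using U(2) q unfolding C_iff by (metis (full_types))
        next
          case False
          then have "D q x \<in> ?psd" using U(2) q unfolding C_iff by presburger
          with False show ?thesis using psd_pos[OF q _ nonzero[OF nz q]] by blast
        qed
        then show ?thesis using U(1) by auto
      qed
      from this[OF TT'(1,3)] this[OF TT'(2,4)] show ?thesis by simp
    qed
  qed (use I S in auto)
  then show ?thesis using S(1) by (simp add: card_Pow)
qed

text \<open>With \<open>r\<close> as \<open>N / m\<close> rounded up, \<open>m\<close>-th roots
  leave \<open>2 powr (N / m) \<le> 8 * n * r + 2\<close>, where only the ratio matters. An
  exponential in that ratio cannot stay below an affine function beyond the claimed value.\<close>

lemma vc_bound_numeric:
  fixes N m n :: nat
  assumes m: "0 < m" and n: "0 < n"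
    and bound: "\<And>r. N \<le> r * m \<Longrightarrow> 2 ^ N \<le> (2 * (2 * (r * (2 * n)) + 1)) ^ m"
  shows "real N \<le> 2 * real m * log 2 (4 * exp 1 * (real n)\<^sup>2)"
proof (rule ccontr)
  assume less: "\<not> ?thesis"
  \<comment> \<open>The claim reads \<open>s \<le> log 2 (4 * exp 1 * n\<^sup>2)\<close>. Halving
    the ratio makes \<open>2 powr (2 * s)\<close> a square: one factor beats
    \<open>4 * exp 1 * n\<^sup>2\<close>, the other the linear term.\<close>
  define s where "s = real N / real m / 2"
  define r where "r = nat \<lceil>2 * s\<rceil>"
  have s0: "0 \<le> s" and Ns: "real N = 2 * s * real m" using m by (auto simp: s_def)
  have r: "2 * s \<le> real r" "real r \<le> 2 * s + 1" using s0 by (auto simp: r_def)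
  have "real N \<le> real r * real m" unfolding Ns using r(1) by (intro mult_right_mono) auto
  then have "N \<le> r * m" by (metis of_nat_le_iff of_nat_mult)
  from bound[OF this] have "real (2 ^ N) \<le> real ((2 * (2 * (r * (2 * n)) + 1)) ^ m)"
    by (simp only: of_nat_le_iff)
  then have "2 ^ N \<le> (8 * real n * real r + 2) ^ m" by (simp add: algebra_simps)
  moreover have "2 ^ N = (2 powr (2 * s)) ^ m"
    by (simp add: powr_realpow[symmetric] Ns powr_powr)
  ultimately have "(2 powr (2 * s)) ^ m \<le> (8 * real n * real r + 2) ^ m" by simp
  then have "2 powr (2 * s) \<le> 8 * real n * real r + 2"
    using m by (subst (asm) power_mono_iff) auto
  also have "\<dots> \<le> 8 * real n * (2 * s + 1) + 2" using r(2) by (simp add: mult_left_mono)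
  also have "\<dots> \<le> (real n)\<^sup>2 * (16 * s + 10)"
  proof -
    have "1 \<le> real n" "real n \<le> (real n)\<^sup>2" using n by (auto simp: power2_eq_square)
    moreover from this have "real n * s \<le> (real n)\<^sup>2 * s" using s0 by (intro mult_right_mono)
    moreover have "8 * real n * (2 * s + 1) + 2 = 16 * (real n * s) + 8 * real n + 2"
      by (simp add: algebra_simps)
    moreover have "(real n)\<^sup>2 * (16 * s + 10) = 16 * ((real n)\<^sup>2 * s) + 10 * (real n)\<^sup>2"
      by (simp add: algebra_simps)
    ultimately show ?thesis by linarith
  qed
  finally have upper: "2 powr (2 * s) \<le> (real n)\<^sup>2 * (16 * s + 10)" .
  have e2: "2 \<le> exp (1 :: real)" using exp_ge_add_one_self[of 1] by simp
  have n1: "1 \<le> (real n)\<^sup>2" using n by simp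
  have "log 2 (4 * exp 1 * (real n)\<^sup>2) < s" using less m by (simp add: Ns)
  then have big: "4 * exp 1 * (real n)\<^sup>2 < 2 powr s" using n by (subst (asm) log_less_iff) auto
  have "8 * 1 \<le> 4 * exp 1 * (real n)\<^sup>2" using e2 n1 by (intro mult_mono) auto
  with big have "2 powr 3 < 2 powr s" by simp
  then have s3: "3 < s" using powr_less_cancel_iff[of 2 3 s] by simp
  have "2 powr s = 8 * 2 powr (s - 3)" by (simp add: powr_diff)
  moreover have "1 + (s - 3) * ln 2 \<le> 2 powr (s - 3)"
    using exp_ge_add_one_self[of "(s - 3) * ln 2"] by (simp add: powr_def)
  moreover have "(s - 3) * (1 / 2) \<le> (s - 3) * ln 2"
    using s3 ln_le_minus_one[of "1 / 2"] by (intro mult_left_mono) (auto simp: ln_div)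
  \<comment> \<open>The tangent at \<open>s = 3\<close> with \<open>ln 2\<close> lowered to
    \<open>1 / 2\<close>, that is \<open>8 * (1 + (s - 3) / 2)\<close>.\<close>
  ultimately have lin: "4 * s - 4 \<le> 2 powr s" by argo
  have "(real n)\<^sup>2 * (16 * s + 10) \<le> (real n)\<^sup>2 * (8 * (4 * s - 4))"
    using s3 by (intro mult_left_mono) auto
  also have "\<dots> = (8 * (real n)\<^sup>2) * (4 * s - 4)" by simp
  also have "\<dots> \<le> (4 * exp 1 * (real n)\<^sup>2) * (4 * s - 4)"
    using e2 s3 by (intro mult_right_mono) auto
  also have "\<dots> < 2 powr s * (4 * s - 4)" using big s3 by (intro mult_strict_right_mono) auto
  also have "\<dots> \<le> 2 powr s * 2 powr s" using lin by (intro mult_left_mono) auto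
  also have "\<dots> = 2 powr (2 * s)" by (simp flip: powr_add)
  finally show False using upper by simp
qed

text \<open>Entries of degree at most 2 cover the affine and the bilinear setting alike; the
  determinants then have degree at most \<open>2 * CARD('n)\<close>.\<close>

lemma card_shattered_le:
  fixes M :: "'q \<Rightarrow> ('i \<Rightarrow> real) \<Rightarrow> real^'n^'n"
  assumes I: "finite I" "I \<noteq> {}" and S: "finite S"
    and poly: "\<And>q i j. q \<in> S \<Longrightarrow> wpoly I (\<lambda>_. 1) 2 (\<lambda>x. M q x $ i $ j)"
    and sym: "\<And>q x. q \<in> S \<Longrightarrow> sym_mat (M q x)"
    and shat: "\<And>T. T \<subseteq> S \<Longrightarrow> \<exists>x. (\<forall>i. i \<notin> I \<longrightarrow> x i = 0) \<and> {q \<in> S. \<not> pos_def (M q x)} = T"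
  shows "real (card S) \<le> 2 * real (card I) * log 2 (4 * exp 1 * (real CARD('n))\<^sup>2)"
  using I by (intro vc_bound_numeric shattered_power_le[OF I(1) S _ poly sym shat]) (auto simp: card_gt_0_iff)

section \<open>The LMI and BMI families\<close>

lemma sym_mat_add: "sym_mat A \<Longrightarrow> sym_mat B \<Longrightarrow> sym_mat (A + B)"
  by (simp add: sym_mat_def transpose_def vec_eq_iff)

lemma sym_mat_scaleR: "sym_mat A \<Longrightarrow> sym_mat (c *\<^sub>R A)"
  by (simp add: sym_mat_def transpose_def vec_eq_iff)

lemma sym_mat_sum: "(\<And>i. i \<in> A \<Longrightarrow> sym_mat (f i)) \<Longrightarrow> sym_mat (\<Sum>i\<in>A. f i)"
  by (induction A rule: infinite_finite_induct)
     (auto intro: sym_mat_add simp: sym_mat_def[of 0] transpose_def vec_eq_iff)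

theorem theorem2:
  fixes Q :: "(real^'l) set"
    and mx my :: nat
  assumes "mx > 0" and "my > 0"
  shows "(\<forall>(F0 :: real^'l \<Rightarrow> real^'n^'n) F.
            (\<forall>q\<in>Q. sym_mat (F0 q) \<and> (\<forall>i\<in>{1..mx}. sym_mat (F i q))) \<longrightarrow>
            vc_dim_le (G_LMI F0 F mx) Q (2 * real mx * log 2 (4 * exp 1 * real (CARD('n))^2)))
       \<and> (\<forall>(F0 :: real^'l \<Rightarrow> real^'n^'n) F G H.
            (\<forall>q\<in>Q. sym_mat (F0 q) \<and> (\<forall>i\<in>{1..mx}. sym_mat (F i q))
                  \<and> (\<forall>j\<in>{1..my}. sym_mat (G j q))
                  \<and> (\<forall>i\<in>{1..mx}. \<forall>j\<in>{1..my}. sym_mat (H i j q))) \<longrightarrow>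
            vc_dim_le (G_BMI F0 F G H mx my) Q
              (2 * real (mx + my) * log 2 (4 * exp 1 * real (CARD('n))^2)))"
proof (intro conjI allI impI)
  fix F0 :: "real^'l \<Rightarrow> real^'n^'n" and F :: "nat \<Rightarrow> real^'l \<Rightarrow> real^'n^'n"
  assume sym: "\<forall>q\<in>Q. sym_mat (F0 q) \<and> (\<forall>i\<in>{1..mx}. sym_mat (F i q))"
  show "vc_dim_le (G_LMI F0 F mx) Q (2 * real mx * log 2 (4 * exp 1 * real (CARD('n))^2))"
    unfolding vc_dim_le_def
  proof (intro allI impI, elim conjE)
    fix S assume S: "finite S" "S \<subseteq> Q" "shatters (G_LMI F0 F mx) S"
    have "real (card S) \<le> 2 * real (card {1..mx}) * log 2 (4 * exp 1 * (real CARD('n))\<^sup>2)"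
    proof (rule card_shattered_le[where M = "\<lambda>q x. F_LMI F0 F mx x q"])
      show "wpoly {1..mx} (\<lambda>_. 1) 2 (\<lambda>x. F_LMI F0 F mx x q $ i $ j)" for q i j
        by (auto simp: F_LMI_def intro!: wpoly.intros wpoly_sum wpoly.var_mult[OF wpoly.const[of _ _ 0]])
      show "sym_mat (F_LMI F0 F mx x q)" if "q \<in> S" for q x
        unfolding F_LMI_def using sym S(2) that
        by (intro sym_mat_add sym_mat_sum sym_mat_scaleR) auto
      show "\<exists>x. (\<forall>i. i \<notin> {1..mx} \<longrightarrow> x i = 0) \<and> {q \<in> S. \<not> pos_def (F_LMI F0 F mx x q)} = T"
        if "T \<subseteq> S" for T
        using S(3) that unfolding shatters_def G_LMI_def by blast
    qed (use S assms in auto)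
    then show "real (card S) \<le> 2 * real mx * log 2 (4 * exp 1 * real (CARD('n))^2)" by simp
  qed
next
  fix F0 :: "real^'l \<Rightarrow> real^'n^'n" and F G :: "nat \<Rightarrow> real^'l \<Rightarrow> real^'n^'n"
    and H :: "nat \<Rightarrow> nat \<Rightarrow> real^'l \<Rightarrow> real^'n^'n"
  assume sym: "\<forall>q\<in>Q. sym_mat (F0 q) \<and> (\<forall>i\<in>{1..mx}. sym_mat (F i q))
                  \<and> (\<forall>j\<in>{1..my}. sym_mat (G j q))
                  \<and> (\<forall>i\<in>{1..mx}. \<forall>j\<in>{1..my}. sym_mat (H i j q))"
  show "vc_dim_le (G_BMI F0 F G H mx my) Q
              (2 * real (mx + my) * log 2 (4 * exp 1 * real (CARD('n))^2))"
    unfolding vc_dim_le_def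
  proof (intro allI impI, elim conjE)
    fix S assume S: "finite S" "S \<subseteq> Q" "shatters (G_BMI F0 F G H mx my) S"
    \<comment> \<open>\<open>x\<close> and \<open>y\<close> are merged into one assignment on a
      disjoint union of index sets, whose cardinality is the number of parameters.\<close>
    let ?I = "{1..mx} <+> {1..my}"
    let ?M = "\<lambda>q z. F_BMI F0 F G H mx my (\<lambda>i. z (Inl i)) (\<lambda>j. z (Inr j)) q"
    have "real (card S) \<le> 2 * real (card ?I) * log 2 (4 * exp 1 * (real CARD('n))\<^sup>2)"
    proof (rule card_shattered_le[where M = ?M])
      have bilinear: "wpoly ?I (\<lambda>_. 1) 2 (\<lambda>z. z (Inl i) * z (Inr j) * c)"
        if "i \<in> {1..mx}" "j \<in> {1..my}" for i j c
      proof -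
        have "wpoly ?I (\<lambda>_. 1) 1 (\<lambda>z. z (Inr j) * c)"
          using that by (intro wpoly.var_mult[OF wpoly.const[of _ _ 0]]) auto
        from wpoly.var_mult[OF this, of "Inl i" 2] that show ?thesis by (simp add: mult.assoc InlI)
      qed
      have linear: "wpoly ?I (\<lambda>_. 1) 2 (\<lambda>z. z v * c)" if "v \<in> ?I" for v c
        using that by (intro wpoly.var_mult[OF wpoly.const[of _ _ 0]]) auto
      show "wpoly ?I (\<lambda>_. 1) 2 (\<lambda>z. ?M q z $ i $ j)" for q i j
        unfolding F_BMI_def sum_component vector_add_component vector_scaleR_component real_scaleR_def
        by (intro wpoly.add wpoly_sum wpoly.const linear bilinear) auto
      show "sym_mat (?M q z)" if "q \<in> S" for q z
        unfolding F_BMI_def using sym S(2) that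
        by (intro sym_mat_add sym_mat_sum sym_mat_scaleR) auto
      show "\<exists>z. (\<forall>v. v \<notin> ?I \<longrightarrow> z v = 0) \<and> {q \<in> S. \<not> pos_def (?M q z)} = T" if "T \<subseteq> S" for T
      proof -
        obtain h where h: "h \<in> G_BMI F0 F G H mx my" "{q \<in> S. h q} = T"
          using S(3)[unfolded shatters_def, rule_format, OF \<open>T \<subseteq> S\<close>] by blast
        obtain x y where xy: "h = (\<lambda>q. \<not> pos_def (F_BMI F0 F G H mx my x y q))"
          "\<forall>i. i \<notin> {1..mx} \<longrightarrow> x i = 0" "\<forall>j. j \<notin> {1..my} \<longrightarrow> y j = 0"
          using h(1) by (auto simp only: G_BMI_def mem_Collect_eq)
        have "case_sum x y v = 0" if "v \<notin> ?I" for v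
          using that xy(2,3) by (cases v) (auto simp: InlI InrI)
        moreover have "{q \<in> S. \<not> pos_def (?M q (case_sum x y))} = T"
          using h(2) by (simp only: xy(1) sum.case)
        ultimately show ?thesis by blast
      qed
    qed (use S assms in auto)
    then show "real (card S) \<le> 2 * real (mx + my) * log 2 (4 * exp 1 * real (CARD('n))^2)"
      by (simp add: card_Plus)
  qed
qed

end
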